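(* Let $J_n$ be the limit set of the iterated function system consisting of the first $n$ inverse branches $g_1,\dots,g_n$, $g_k(x)=-\frac{1}{k(k+1)}x+\frac1k$, of the piecewise linear analogue $G$ of the Gauss map, let $h_n$ be the Hausdorff dimension of $J_n$, and let $H_n$ be the $h_n$-dimensional Hausdorff measure of $J_n$. Then $$\lim_{n\to\infty}\frac{1-H_n}{1-h_n}\cdot\frac{1}{\ln n}=1.$$ Thus, $$\lim_{n\to\infty}\frac{n(1-H_n)}{\ln n}=\frac1\chi,$$ where $$\chi=\int_0^1\log|G'(x)|\,dx=\sum_{n=1}^\infty\frac{1}{n(n+1)}\log\big(n(n+1)\big)$$ is the Lyapunov exponent of $G$ with respect to Lebesgue measure.
   Context: $\mathbb N=\{1,2,\dots\}$; $\log=\ln$ is the natural logarithm. The piecewise linear analogue $G$ of the Gauss map is given on each interval $[\frac1{k+1},\frac1k]$, $k\in\mathbb N$, by the decreasing affine map $f_k(x)=-k(k+1)x+k+1$ onto $[0,1]$; its inverse branches are $g_k:[0,1]\to[\frac1{k+1},\frac1k]$, $g_k(x)=-\frac{1}{k(k+1)}x+\frac1k$. For a finite word $\omega=(\omega_1,\dots,\omega_m)$ of positive integers put $g_\omega=g_{\omega_1}\circ\dots\circ g_{\omega_m}$. The limit set is $$J_n=\bigcap_{k=1}^\infty\ \bigcup_{\omega\in\{1,\dots,n\}^k}g_\omega([0,1]),$$ i.e. the set of all $x\in[0,1]$ whose $G$-trajectory never enters $[0,\frac1{n+1}]$. $h_n=\dim_H(J_n)$, and $H_n=H_{h_n}(J_n)$,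 where $H_h$ is the $h$-dimensional Hausdorff measure normalized by $H_h(A)=\lim_{\delta\to0}\inf\{\sum_i\mathrm{diam}^h(U_i): A\subset\bigcup_iU_i,\ \mathrm{diam}(U_i)\le\delta\}$ (so $H_1$ is Lebesgue measure on $\mathbb R$). *)

theory Defs
  imports "HOL-Analysis.Analysis"
begin

section \<open>Hausdorff measure and dimension\<close>

text \<open>The term \<open>diam(U)\<^sup>h\<close> of a covering sum. The empty set contributes 0, so that sequences of sets
  also represent finite covers; for \<open>h = 0\<close> a nonempty set contributes 1 (HOL has \<open>0 powr 0 = 0\<close>).\<close>

definition diam_pow :: "real \<Rightarrow> 'a::metric_space set \<Rightarrow> real" where
  "diam_pow h U = (if U = {} then 0 else if h = 0 then 1 else diameter U powr h)"

text \<open>\<^const>\<open>diameter\<close> is meaningless on unbounded sets, hence the boundedness condition.\<close>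

definition delta_cover :: "real \<Rightarrow> 'a::metric_space set \<Rightarrow> (nat \<Rightarrow> 'a set) \<Rightarrow> bool" where
  "delta_cover \<delta> A U \<longleftrightarrow> A \<subseteq> (\<Union>i. U i) \<and> (\<forall>i. bounded (U i) \<and> diameter (U i) \<le> \<delta>)"

definition hausdorff_pre :: "real \<Rightarrow> real \<Rightarrow> 'a::metric_space set \<Rightarrow> ennreal" where
  "hausdorff_pre h \<delta> A = (INF U \<in> {U. delta_cover \<delta> A U}. \<Sum>i. ennreal (diam_pow h (U i)))"

definition hausdorff_measure :: "real \<Rightarrow> 'a::metric_space set \<Rightarrow> ennreal" where
  "hausdorff_measure h A = Lim (at_right 0) (\<lambda>\<delta>. hausdorff_pre h \<delta> A)"

lemma hausdorff_pre_antimono: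
  "\<delta> \<le> \<epsilon> \<Longrightarrow> hausdorff_pre h \<epsilon> A \<le> hausdorff_pre h \<delta> A"
  unfolding hausdorff_pre_def delta_cover_def
  by (rule INF_superset_mono) (auto intro: order_trans)

lemma hausdorff_pre_tendsto_SUP:
  "((\<lambda>\<delta>. hausdorff_pre h \<delta> A) \<longlongrightarrow> (SUP \<delta> \<in> {0<..}. hausdorff_pre h \<delta> A)) (at_right 0)"
proof (rule order_tendstoI)
  fix a assume "a < (SUP \<delta> \<in> {0<..}. hausdorff_pre h \<delta> A)"
  then obtain d :: real where d: "d > 0" "a < hausdorff_pre h d A"
    by (auto simp: less_SUP_iff)
  then have "\<forall>y>0. y < d \<longrightarrow> a < hausdorff_pre h y A"
    by (meson hausdorff_pre_antimono less_le_trans less_imp_le)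
  then show "eventually (\<lambda>\<delta>. a < hausdorff_pre h \<delta> A) (at_right 0)"
    using d(1) by (auto simp: eventually_at_right_field)
next
  fix a assume *: "(SUP \<delta> \<in> {0<..}. hausdorff_pre h \<delta> A) < a"
  have "hausdorff_pre h y A < a" if "y > 0" for y
    using that by (intro le_less_trans[OF SUP_upper *]) auto
  then show "eventually (\<lambda>\<delta>. hausdorff_pre h \<delta> A < a) (at_right 0)"
    by (auto simp: eventually_at_right_field intro: exI[of _ 1])
qed

lemma hausdorff_measure_eq_SUP:
  "hausdorff_measure h A = (SUP \<delta> \<in> {0<..}. hausdorff_pre h \<delta> A)"
  unfolding hausdorff_measure_def
  by (rule tendsto_Lim[OF _ hausdorff_pre_tendsto_SUP]) simp

text \<open>Only for subsets of the line: there \<open>hausdorff_measure s A = 0\<close> for every \<open>s > 1\<close>, so that the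
  infimum is over a nonempty set, and the dimension is a real number.\<close>

definition hausdorff_dim :: "real set \<Rightarrow> real" where
  "hausdorff_dim A = Inf {s. 0 \<le> s \<and> hausdorff_measure s A = 0}"


section \<open>The piecewise linear Gauss map and its limit sets\<close>

definition gauss_branch :: "nat \<Rightarrow> real \<Rightarrow> real" where
  "gauss_branch k x = - (real k * (real k + 1)) * x + real k + 1"

text \<open>For \<open>x\<close> in \<open>(1/(k+1), 1/k]\<close> we have \<open>\<lfloor>1/x\<rfloor> = k\<close>. The branches disagree at the common endpoints
  \<open>1/k\<close>, where this picks branch \<open>k\<close>; the choice there and outside \<open>(0,1]\<close> is immaterial.\<close>

definition lin_gauss :: "real \<Rightarrow> real" where
  "lin_gauss x = gauss_branch (nat \<lfloor>1 / x\<rfloor>) x"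

definition gauss_inv :: "nat \<Rightarrow> real \<Rightarrow> real" where
  "gauss_inv k x = - (1 / (real k * (real k + 1))) * x + 1 / real k"

definition gauss_inv_word :: "nat list \<Rightarrow> real \<Rightarrow> real" where
  "gauss_inv_word \<omega> = foldr (\<lambda>k f. gauss_inv k \<circ> f) \<omega> id"

definition limit_set :: "nat \<Rightarrow> real set" where
  "limit_set n = (\<Inter>k\<in>{1..}. \<Union>\<omega>\<in>{\<omega>. length \<omega> = k \<and> set \<omega> \<subseteq> {1..n}}. gauss_inv_word \<omega> ` {0..1})"

definition limit_dim :: "nat \<Rightarrow> real" where
  "limit_dim n = hausdorff_dim (limit_set n)"

text \<open>\<^const>\<open>enn2real\<close> loses nothing for \<open>n \<ge> 1\<close>: with \<open>h = limit_dim n\<close>, the covers of \<open>limit_set n\<close> by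
  \<open>gauss_inv_word \<omega> ` {0..1}\<close>, \<open>\<omega>\<close> of fixed length, have \<open>h\<close>-sum 1, so the measure is at most 1.\<close>

definition limit_measure :: "nat \<Rightarrow> real" where
  "limit_measure n = enn2real (hausdorff_measure (limit_dim n) (limit_set n))"

definition lyapunov :: real where
  "lyapunov = (LBINT x:{0..1}. ln \<bar>deriv lin_gauss x\<bar>)"

end

theory Submission
  imports Defs "HOL-Real_Asymp.Real_Asymp"
begin

text \<open>
  Write \<open>r\<^sub>j = 1/(j(j+1))\<close> for the contraction ratios. Since the branches map \<open>[0,1]\<close> onto adjacent
  intervals, \<open>h = h\<^sub>n\<close> is the solution of \<open>\<Sum>\<^sub>j\<^sub>\<le>\<^sub>n r\<^sub>j\<^sup>h = 1\<close>; put \<open>\<epsilon> = 1 - h\<close>. Giving the cylinder of a word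
  \<open>\<omega>\<close> the mass \<open>r\<^sub>\<omega>\<^sup>h\<close> distributes a unit of mass over \<open>J\<^sub>n\<close>, and \<open>1/H\<^sub>n\<close> is the supremum of
  \<open>mass(F)/|F|\<^sup>h\<close> over intervals \<open>F\<close>. Both limits follow from the fact that it is \<open>n\<^sup>\<epsilon>\<close> up to a
  factor \<open>1 + O(\<epsilon>)\<close>. It makes \<open>1 - H\<^sub>n\<close> equal to \<open>\<epsilon> ln n + O(\<epsilon>)\<close> up to terms of smaller order,
  where \<open>\<epsilon>\<close> is of order \<open>1/n\<close>.

  An interval with a ratio this large is the hull \<open>F\<close> of the branches from \<open>n/2\<close> to \<open>n\<close>. Its length is
  about \<open>1/n\<close>, but it is composed of pieces of length about \<open>1/n\<^sup>2\<close>, so that its mass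
  \<open>\<Sum> r\<^sub>j r\<^sub>j\<^sup>-\<^sup>\<epsilon>\<close> is about \<open>|F| n\<^sup>2\<^sup>\<epsilon>\<close>, while \<open>|F|\<^sup>h = |F| |F|\<^sup>-\<^sup>\<epsilon>\<close> is about \<open>|F| n\<^sup>\<epsilon>\<close>. Covering \<open>J\<^sub>n \<inter> F\<close> by
  the single set \<open>F\<close> and the other pieces by scaled copies of a good cover of \<open>J\<^sub>n\<close> turns this into an
  upper bound for \<open>H\<^sub>n\<close> (\<open>limit_measure_le_ratio\<close>, \<open>limit_measure_le\<close>).

  No interval does better (\<open>mass_interval_le\<close>). After zooming in, an interval consists of at most \<open>n\<close>
  complete first-level pieces and an incomplete one at each end. For the complete ones the ratio is at
  most \<open>n\<^sup>\<epsilon>\<close> by concavity (\<open>sum_powr_le_card_powr\<close>). The rescaled incomplete pieces are intervals \<open>[0,s)\<close> or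
  \<open>(t,1]\<close>, which decompose in the same way with only one incomplete piece. This piece takes up at most
  half of the length, apart from the case of an interval inside the first branch, and
  therefore the factors picked up in the recursion do not accumulate (\<open>weighted_powr_add_le\<close>,
  \<open>end_bound_end_const\<close>). The mass distribution principle (\<open>covering_sum_ge\<close>) then bounds \<open>H\<^sub>n\<close> from below.

  For the size of \<open>\<epsilon>\<close>, subtract \<open>\<Sum>\<^sub>j\<^sub>\<le>\<^sub>n r\<^sub>j = 1 - 1/(n+1)\<close> from \<open>\<Sum>\<^sub>j\<^sub>\<le>\<^sub>n r\<^sub>j r\<^sub>j\<^sup>-\<^sup>\<epsilon> = 1\<close>: to first order,
  \<open>\<epsilon> \<Sum> r\<^sub>j ln(1/r\<^sub>j) = 1/(n+1)\<close>, and the sum tends to \<open>\<chi>\<close> (\<open>dimension_defect_tendsto\<close>).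
\<close>

section \<open>Sums of powers with exponent below one\<close>

text \<open>Jensen's inequality for \<open>x\<^sup>h\<close>, obtained by comparing each \<open>x i\<close> with the mean by the weighted
  inequality of arithmetic and geometric means. It bounds the gain of mass that an interval has from
  being cut into pieces.\<close>

lemma sum_powr_le_card_powr:
  fixes x :: "'a \<Rightarrow> real"
  assumes "finite I" and nonneg: "\<And>i. i \<in> I \<Longrightarrow> 0 \<le> x i" and h: "0 < h" "h < 1"
  shows "(\<Sum>i\<in>I. x i powr h) \<le> real (card I) powr (1 - h) * (\<Sum>i\<in>I. x i) powr h"
proof (cases "(\<Sum>i\<in>I. x i) = 0")
  case True
  then have "x i = 0" if "i \<in> I" for i
    using sum_nonneg_eq_0_iff[OF \<open>finite I\<close>] nonneg that by blast
  then show ?thesis by simp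
next
  case False
  define X where "X = (\<Sum>i\<in>I. x i)"
  define N where "N = real (card I)"
  have X: "0 < X" using False nonneg sum_nonneg[of I x] unfolding X_def by fastforce
  have N: "0 < N"
    using False \<open>finite I\<close> by (auto simp: N_def card_gt_0_iff)
  \<comment> \<open>The mean, for which the sum of the linear upper bounds is sharp.\<close>
  define c where "c = X / N"
  have c: "0 < c" using X N by (simp add: c_def)
  have "x i powr h * c powr (1 - h) \<le> h * x i + (1 - h) * c" if "i \<in> I" for i
    using Youngs_inequality_0[of h "1 - h" "x i" c] h nonneg[OF that] c
    by (cases "x i = 0") auto
  then have "(\<Sum>i\<in>I. x i powr h * c powr (1 - h)) \<le> (\<Sum>i\<in>I. h * x i + (1 - h) * c)"
    by (rule sum_mono)
  also have "\<dots> = h * X + N * ((1 - h) * c)"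
    by (simp add: sum.distrib sum_distrib_left X_def N_def)
  also have "\<dots> = X" using N by (simp add: c_def left_diff_distrib)
  finally have "(\<Sum>i\<in>I. x i powr h) * c powr (1 - h) \<le> X"
    by (simp add: sum_distrib_right)
  then have "(\<Sum>i\<in>I. x i powr h) \<le> X / c powr (1 - h)"
    using c by (simp add: pos_le_divide_eq)
  also have "X / c powr (1 - h) = N powr (1 - h) * (X / X powr (1 - h))"
    using X N by (simp add: c_def powr_divide)
  also have "X / X powr (1 - h) = X powr h"
    using X powr_diff[of X 1 "1 - h"] by simp
  finally show ?thesis by (simp add: X_def N_def)
qed

lemma powr_add_le_midpoint:
  fixes u v :: real
  assumes "0 \<le> u" "0 \<le> v" "0 < h" "h < 1"
  shows "u powr h + v powr h \<le> 2 * ((u + v) / 2) powr h"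
proof -
  have "u powr h + v powr h \<le> 2 powr (1 - h) * (u + v) powr h"
    using sum_powr_le_card_powr[of "{0, 1 :: nat}" "\<lambda>i. if i = 0 then u else v" h] assms by simp
  also have "\<dots> = 2 * ((u + v) / 2) powr h"
    using assms by (simp add: powr_diff powr_divide)
  finally show ?thesis .
qed

lemma powr_add3_le:
  fixes u v w :: real
  assumes "0 \<le> u" "0 \<le> v" "0 \<le> w" "0 < h" "h < 1"
  shows "u powr h + v powr h + w powr h \<le> 3 powr (1 - h) * (u + v + w) powr h"
  using sum_powr_le_card_powr[of "{0, 1, 2 :: nat}"
      "\<lambda>i. if i = 0 then u else if i = 1 then v else w" h] assms
  by (simp add: add.assoc)

text \<open>The reason why errors do not accumulate in the recursion for end intervals. There \<open>u\<close> is the length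
  of the incomplete piece, with the ratio bound \<open>K\<close>, and \<open>v\<close> that of the rest, with the smaller bound \<open>B\<close>.
  As \<open>u\<close> is the shorter part, the larger bound \<open>K\<close> may be averaged with \<open>B\<close>: the new bound \<open>(K + B)/2\<^sup>h\<close> is
  a contraction in \<open>K\<close>, because \<open>2\<^sup>h > 1\<close>.\<close>

lemma weighted_powr_add_le:
  fixes u v :: real
  assumes "0 \<le> u" "u \<le> v" "0 \<le> B" "B \<le> K" "0 < h" "h < 1"
  shows "K * u powr h + B * v powr h \<le> (K + B) / 2 powr h * (u + v) powr h"
proof -
  have "K * u powr h + B * v powr h = (K - B) * u powr h + B * (u powr h + v powr h)"
    by (simp add: algebra_simps)
  also have "\<dots> \<le> (K - B) * ((u + v) / 2) powr h + B * (2 * ((u + v) / 2) powr h)"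
    using assms powr_add_le_midpoint[of u v h]
    by (intro add_mono mult_left_mono powr_mono2) auto
  also have "\<dots> = (K + B) * ((u + v) / 2) powr h"
    by (simp add: algebra_simps)
  finally show ?thesis using assms by (simp add: powr_divide)
qed

lemma powr_add_le_add_powr:
  fixes a b :: real
  assumes "0 \<le> a" "0 < b" "0 < h" "h \<le> 1"
  shows "(a + b) powr h \<le> a powr h + b powr h"
proof -
  have split: "(a + b) powr h = a * (a + b) powr (h - 1) + b * (a + b) powr (h - 1)"
    using assms by (simp add: powr_diff distrib_right[symmetric] add_divide_distrib[symmetric])
  have "x * (a + b) powr (h - 1) \<le> x powr h" if "0 \<le> x" "x \<le> a + b" for x
  proof (cases "x = 0")
    case False
    then have "x * (a + b) powr (h - 1) \<le> x * x powr (h - 1)"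
      using that assms by (intro mult_left_mono powr_mono2') auto
    then show ?thesis using False that by (simp add: powr_diff)
  qed simp
  then show ?thesis using split assms by (smt (verit))
qed

section \<open>The inverse branches\<close>

definition contraction :: "nat \<Rightarrow> real" where
  "contraction j = 1 / (real j * (real j + 1))"

lemma contraction_pos: "1 \<le> j \<Longrightarrow> 0 < contraction j"
  by (simp add: contraction_def)

lemma contraction_le_half: "1 \<le> j \<Longrightarrow> contraction j \<le> 1 / 2"
proof -
  assume "1 \<le> j"
  then have "1 * 2 \<le> real j * (real j + 1)" by (intro mult_mono) auto
  then show ?thesis by (simp add: contraction_def divide_simps)
qed

lemma contraction_eq: "1 \<le> j \<Longrightarrow> contraction j = 1 / real j - 1 / (real j + 1)"
  by (simp add: contraction_def field_simps)

lemma sum_contraction: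
  assumes "1 \<le> a" "a \<le> b"
  shows "(\<Sum>j=a..<b. contraction j) = 1 / real a - 1 / real b"
  using assms(2)
proof (induction b rule: dec_induct)
  case (step m)
  then show ?case using assms(1) contraction_eq[of m] by (simp add: add.commute)
qed simp

lemma gauss_inv_eq: "gauss_inv j x = 1 / real j - contraction j * x"
  by (simp add: gauss_inv_def contraction_def)

lemma gauss_branch_eq: "1 \<le> j \<Longrightarrow> gauss_branch j x = (1 / real j - x) / contraction j"
  by (simp add: gauss_branch_def contraction_def field_simps)

text \<open>The branches reverse the order, so that preimages of left rays are right rays and conversely. This is
  why \<open>[0,s)\<close> and \<open>(t,1]\<close> have to be treated together below.\<close>

lemma gauss_inv_less_iff: "1 \<le> j \<Longrightarrow> gauss_inv j x < s \<longleftrightarrow> gauss_branch j s < x"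
  using contraction_pos[of j] unfolding gauss_inv_eq
  by (simp only: gauss_branch_eq pos_divide_less_eq) argo

lemma less_gauss_inv_iff: "1 \<le> j \<Longrightarrow> s < gauss_inv j x \<longleftrightarrow> x < gauss_branch j s"
  using contraction_pos[of j] unfolding gauss_inv_eq
  by (simp only: gauss_branch_eq pos_less_divide_eq) argo

lemma gauss_branch_gauss_inv: "1 \<le> j \<Longrightarrow> gauss_branch j (gauss_inv j y) = y"
  using contraction_pos[of j] by (simp add: gauss_branch_eq gauss_inv_eq)

lemma one_minus_gauss_branch:
  "1 \<le> j \<Longrightarrow> 1 - gauss_branch j x = (x - 1 / (real j + 1)) / contraction j"
  by (simp add: gauss_branch_def contraction_def field_simps)

lemma dist_gauss_inv: "1 \<le> j \<Longrightarrow> dist (gauss_inv j x) (gauss_inv j y) = contraction j * dist x y"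
proof -
  assume "1 \<le> j"
  have "gauss_inv j x - gauss_inv j y = contraction j * (y - x)"
    by (simp add: gauss_inv_def contraction_def algebra_simps diff_divide_distrib)
  then show ?thesis using contraction_pos[OF \<open>1 \<le> j\<close>]
    by (simp add: dist_real_def abs_mult abs_minus_commute)
qed

lemma gauss_inv_image_subset:
  assumes "1 \<le> j" "x \<in> {0..1}"
  shows "gauss_inv j x \<in> {1 / (real j + 1)..1 / real j}"
proof -
  have "gauss_branch j (1 / (real j + 1)) = 1" "gauss_branch j (1 / real j) = 0"
    using assms(1) by (auto simp: gauss_branch_def field_simps)
  then show ?thesis
    using gauss_inv_less_iff[OF assms(1), of x "1 / (real j + 1)"]
      less_gauss_inv_iff[OF assms(1), of "1 / real j" x] assms(2)
    by (auto simp: not_less)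
qed

lemma gauss_inv_unit:
  assumes "1 \<le> j" "x \<in> {0..1}"
  shows "gauss_inv j x \<in> {0..1}"
proof -
  have "1 / (real j + 1) \<ge> 0" "1 / real j \<le> 1" using assms by auto
  then show ?thesis
    using gauss_inv_image_subset[OF assms] unfolding atLeastAtMost_iff by linarith
qed

lemma vimage_gauss_inv:
  assumes "1 \<le> j"
  shows "gauss_inv j -` {..<s} = {gauss_branch j s<..}"
    and "gauss_inv j -` {s<..} = {..<gauss_branch j s}"
    and "gauss_inv j -` {s<..<t} = {gauss_branch j t<..<gauss_branch j s}"
  using assms gauss_inv_less_iff[of j] less_gauss_inv_iff[of j] by auto

lemma gauss_branch_ge_1: "1 \<le> j \<Longrightarrow> x \<le> 1 / (real j + 1) \<Longrightarrow> 1 \<le> gauss_branch j x"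
  using one_minus_gauss_branch[of j x] contraction_pos[of j]
  by (smt (verit) divide_nonpos_pos)

lemma gauss_branch_le_0: "1 \<le> j \<Longrightarrow> 1 / real j \<le> x \<Longrightarrow> gauss_branch j x \<le> 0"
  using gauss_branch_eq[of j x] contraction_pos[of j]
  by (smt (verit) divide_nonpos_pos)

lemma reciprocal_le: "1 \<le> i \<Longrightarrow> i < j \<Longrightarrow> 1 / real j \<le> 1 / (real i + 1)"
  by (simp add: frac_le)

text \<open>A bound \<open>m \<le> K u\<^sup>h\<close> is invariant under the similarity of the \<open>j\<close>-th branch.\<close>

lemma contraction_powr_mult_le:
  assumes j: "1 \<le> j" and "0 \<le> u" "m \<le> K * (u / contraction j) powr h"
  shows "contraction j powr h * m \<le> K * u powr h"
proof -
  have "contraction j powr h * m \<le> contraction j powr h * (K * (u / contraction j) powr h)"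
    using assms by (intro mult_left_mono) auto
  also have "\<dots> = K * u powr h"
    using assms contraction_pos[OF j] by (simp add: powr_divide)
  finally show ?thesis .
qed

lemma exists_reciprocal_interval:
  assumes "0 < s" "s \<le> 1"
  obtains l where "1 \<le> l" "1 / (real l + 1) < s" "s \<le> 1 / real l"
proof -
  define l where "l = nat \<lfloor>1 / s\<rfloor>"
  have "1 \<le> 1 / s" using assms by simp
  then have "1 \<le> \<lfloor>1 / s\<rfloor>" by linarith
  then have l: "1 \<le> l" "real l \<le> 1 / s" "1 / s < real l + 1"
    unfolding l_def by linarith+
  show ?thesis
    using l assms by (intro that[of l]) (auto simp: field_simps)
qed

lemma exists_reciprocal_interval':
  assumes "0 < s" "s < 1"
  obtains l where "1 \<le> l" "1 / (real l + 1) \<le> s" "s < 1 / real l"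
proof -
  \<comment> \<open>For \<open>1/s\<close> an integer this is one less than the floor, as required by the strict inequality.\<close>
  define l where "l = nat (\<lceil>1 / s\<rceil> - 1)"
  have "1 < 1 / s" using assms by simp
  then have "2 \<le> \<lceil>1 / s\<rceil>" by linarith
  then have l: "1 \<le> l" "real l < 1 / s" "1 / s \<le> real l + 1"
    unfolding l_def by linarith+
  show ?thesis
    using l assms by (intro that[of l]) (auto simp: field_simps)
qed

section \<open>The limit set as a self-similar compact set\<close>

text \<open>The union of the cylinders of level \<open>k\<close>, including \<open>k = 0\<close>.\<close>

definition level_set :: "nat \<Rightarrow> nat \<Rightarrow> real set" where
  "level_set n k = (\<Union>\<omega>\<in>{\<omega>. length \<omega> = k \<and> set \<omega> \<subseteq> {1..n}}. gauss_inv_word \<omega> ` {0..1})"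

lemma level_set_0: "level_set n 0 = {0..1}"
  by (auto simp: level_set_def gauss_inv_word_def)

lemma level_set_Suc: "level_set n (Suc k) = (\<Union>j\<in>{1..n}. gauss_inv j ` level_set n k)"
proof -
  have *: "{\<omega>. length \<omega> = Suc k \<and> set \<omega> \<subseteq> {1..n}} =
      (\<Union>j\<in>{1..n}. (#) j ` {\<omega>. length \<omega> = k \<and> set \<omega> \<subseteq> {1..n}})"
    by (auto simp: length_Suc_conv image_iff)
  have **: "gauss_inv_word (j # \<omega>) ` {0..1} = gauss_inv j ` gauss_inv_word \<omega> ` {0..1}"
    for j \<omega>
    by (simp add: gauss_inv_word_def image_comp)
  show ?thesis
    unfolding level_set_def * by (simp only: UN_UN_flatten UN_simps(10) **) (simp only: image_UN)
qed

lemma level_set_antimono: "level_set n (Suc k) \<subseteq> level_set n k"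
proof (induction k)
  case 0
  show ?case using gauss_inv_unit by (fastforce simp: level_set_Suc level_set_0)
next
  case (Suc k)
  then show ?case
    by (subst (1 2) level_set_Suc) (intro UN_mono image_mono order.refl)
qed

lemma level_set_decseq: "k \<le> l \<Longrightarrow> level_set n l \<subseteq> level_set n k"
  by (rule lift_Suc_antimono_le[of "level_set n"]) (simp_all add: level_set_antimono)

lemma limit_set_eq: "limit_set n = (\<Inter>k. level_set n k)"
proof -
  have "limit_set n = (\<Inter>k\<in>{1..}. level_set n k)"
    by (simp add: limit_set_def level_set_def)
  also have "\<dots> = (\<Inter>k. level_set n k)"
  proof
    show "(\<Inter>k\<in>{1..}. level_set n k) \<subseteq> (\<Inter>k. level_set n k)"
    proof (rule INT_greatest)
      fix k
      have "(\<Inter>k\<in>{1..}. level_set n k) \<subseteq> level_set n (Suc k)" by (rule INT_lower) simp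
      then show "(\<Inter>k\<in>{1..}. level_set n k) \<subseteq> level_set n k"
        using level_set_antimono by (rule order_trans)
    qed
  qed auto
  finally show ?thesis .
qed

lemma compact_limit_set: "compact (limit_set n)"
proof -
  have *: "compact (level_set n k)" for k
  proof (induction k)
    case (Suc k)
    have "continuous_on (level_set n k) (gauss_inv j)" for j
      unfolding gauss_inv_def by (intro continuous_intros)
    then show ?case unfolding level_set_Suc
      by (intro compact_UN compact_continuous_image Suc) auto
  qed (simp add: level_set_0)
  have "compact (level_set n 0 \<inter> (\<Inter>k. level_set n k))"
    using * by (intro compact_Int_closed closed_INT) (auto intro: compact_imp_closed)
  moreover have "(\<Inter>k. level_set n k) \<subseteq> level_set n 0" by blast
  ultimately show ?thesis by (simp only: limit_set_eq Int_absorb1)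
qed

lemma limit_set_subset: "limit_set n \<subseteq> {0..1}"
  using limit_set_eq[of n] level_set_0[of n] by blast

lemma gauss_inv_limit_set:
  assumes "j \<in> {1..n}" "x \<in> limit_set n"
  shows "gauss_inv j x \<in> limit_set n"
proof -
  have "gauss_inv j x \<in> level_set n (Suc k)" for k
    using assms unfolding level_set_Suc limit_set_eq by blast
  then show ?thesis using level_set_antimono unfolding limit_set_eq by blast
qed

text \<open>The point \<open>2/3\<close> is the fixed point of the first branch.\<close>

lemma two_thirds_in_limit_set:
  assumes "1 \<le> n"
  shows "2 / 3 \<in> limit_set n"
proof -
  have "2 / 3 \<in> level_set n k" for k
  proof (induction k)
    case (Suc k)
    have "2 / 3 = gauss_inv 1 (2 / 3)" by (simp add: gauss_inv_def)
    then show ?case using Suc assms unfolding level_set_Suc by (intro UN_I[of 1]) auto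
  qed (simp add: level_set_0)
  then show ?thesis by (simp add: limit_set_eq)
qed

text \<open>A point \<open>x\<close> of the limit set lies, for every \<open>k\<close>, in the image of the \<open>k\<close>-th level set under some
  branch. As there are finitely many branches and the level sets decrease, one branch serves all \<open>k\<close>.\<close>

lemma limit_set_subset_UN: "limit_set n \<subseteq> (\<Union>j\<in>{1..n}. gauss_inv j ` limit_set n)"
proof
  fix x assume x: "x \<in> limit_set n"
  show "x \<in> (\<Union>j\<in>{1..n}. gauss_inv j ` limit_set n)"
  proof (rule ccontr)
    assume *: "x \<notin> (\<Union>j\<in>{1..n}. gauss_inv j ` limit_set n)"
    have "\<exists>k. x \<notin> gauss_inv j ` level_set n k" if j: "j \<in> {1..n}" for j
    proof (rule ccontr)
      assume "\<nexists>k. x \<notin> gauss_inv j ` level_set n k"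
      then have "\<exists>y\<in>level_set n k. x = gauss_inv j y" for k by blast
      moreover have "y = gauss_branch j x" if "x = gauss_inv j y" for y
        using j that gauss_branch_gauss_inv by simp
      ultimately have "gauss_branch j x \<in> limit_set n" "x = gauss_inv j (gauss_branch j x)"
        unfolding limit_set_eq by blast+
      then show False using * j by blast
    qed
    then obtain k where k: "\<And>j. j \<in> {1..n} \<Longrightarrow> x \<notin> gauss_inv j ` level_set n (k j)" by metis
    define m where "m = (\<Sum>j=1..n. k j)"
    have "x \<notin> gauss_inv j ` level_set n m" if "j \<in> {1..n}" for j
    proof -
      have "k j \<le> m" unfolding m_def using that by (intro member_le_sum) auto
      then show ?thesis using k[OF that] level_set_decseq by blast
    qed
    then have "x \<notin> level_set n (Suc m)" by (auto simp: level_set_Suc)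
    then show False using x by (simp add: limit_set_eq)
  qed
qed

section \<open>Hausdorff premeasures\<close>

lemma diam_pow_nonneg: "0 \<le> diam_pow h U"
  by (simp add: diam_pow_def)

lemma hausdorff_pre_le:
  "delta_cover \<delta> A U \<Longrightarrow> hausdorff_pre h \<delta> A \<le> (\<Sum>i. ennreal (diam_pow h (U i)))"
  unfolding hausdorff_pre_def by (rule INF_lower) simp

lemma hausdorff_pre_greatest:
  "(\<And>U. delta_cover \<delta> A U \<Longrightarrow> c \<le> (\<Sum>i. ennreal (diam_pow h (U i)))) \<Longrightarrow> c \<le> hausdorff_pre h \<delta> A"
  unfolding hausdorff_pre_def by (rule INF_greatest) simp

lemma hausdorff_pre_subset: "A \<subseteq> B \<Longrightarrow> hausdorff_pre h \<delta> A \<le> hausdorff_pre h \<delta> B"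
  by (rule hausdorff_pre_greatest, rule hausdorff_pre_le) (auto simp: delta_cover_def)

lemma hausdorff_pre_le_diam_pow:
  assumes "bounded V" "diameter V \<le> \<delta>" "0 \<le> \<delta>" "A \<subseteq> V"
  shows "hausdorff_pre h \<delta> A \<le> ennreal (diam_pow h V)"
proof -
  define U where "U i = (if i = (0::nat) then V else {})" for i
  have "delta_cover \<delta> A U"
    using assms by (auto simp: delta_cover_def U_def diameter_empty)
  then have "hausdorff_pre h \<delta> A \<le> (\<Sum>i. ennreal (diam_pow h (U i)))"
    by (rule hausdorff_pre_le)
  also have "\<dots> = (\<Sum>i\<in>{0}. ennreal (diam_pow h (U i)))"
    by (rule suminf_finite) (auto simp: U_def diam_pow_def)
  finally show ?thesis by (simp add: U_def)
qed

lemma hausdorff_pre_less_obtain: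
  assumes "hausdorff_pre h \<delta> A < c"
  obtains U where "delta_cover \<delta> A U" "(\<Sum>i. ennreal (diam_pow h (U i))) < c"
  using assms unfolding hausdorff_pre_def by (auto simp: INF_less_iff)

lemma suminf_interleave_le:
  fixes f g :: "nat \<Rightarrow> ennreal"
  shows "(\<Sum>i. if even i then f (i div 2) else g (i div 2)) \<le> suminf f + suminf g"
    (is "suminf ?w \<le> _")
proof -
  have double: "(\<Sum>i<2 * N. ?w i) = (\<Sum>i<N. f i) + (\<Sum>i<N. g i)" for N
    by (induction N) (auto simp: add_ac)
  have "(\<Sum>i<N. ?w i) \<le> suminf f + suminf g" for N
  proof -
    have "(\<Sum>i<N. ?w i) \<le> (\<Sum>i<2 * N. ?w i)" by (intro sum_mono2) auto
    also have "\<dots> \<le> suminf f + suminf g"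
      unfolding double by (intro add_mono sum_le_suminf) auto
    finally show ?thesis .
  qed
  then show ?thesis
    unfolding suminf_eq_SUP by (intro SUP_least)
qed

text \<open>Interleaving a cover of \<open>A\<close> with one of \<open>B\<close> gives a cover of the union.\<close>

lemma hausdorff_pre_Un: "hausdorff_pre h \<delta> (A \<union> B) \<le> hausdorff_pre h \<delta> A + hausdorff_pre h \<delta> B"
proof (rule ennreal_le_epsilon)
  fix e :: real
  assume fin: "hausdorff_pre h \<delta> A + hausdorff_pre h \<delta> B < top" and e: "0 < e"
  have approx: "\<exists>U. delta_cover \<delta> S U \<and>
      (\<Sum>i. ennreal (diam_pow h (U i))) \<le> hausdorff_pre h \<delta> S + ennreal (e / 2)"
    if "hausdorff_pre h \<delta> S < top" for S :: "'a set"
  proof -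
    have "hausdorff_pre h \<delta> S < hausdorff_pre h \<delta> S + ennreal (e / 2)"
      using that e by (simp add: ennreal_lessI)
    then show ?thesis using hausdorff_pre_less_obtain by (metis less_imp_le)
  qed
  have "hausdorff_pre h \<delta> A < top" "hausdorff_pre h \<delta> B < top"
    using fin by (simp_all add: less_top)
  then obtain U V where U: "delta_cover \<delta> A U"
      "(\<Sum>i. ennreal (diam_pow h (U i))) \<le> hausdorff_pre h \<delta> A + ennreal (e / 2)"
    and V: "delta_cover \<delta> B V"
      "(\<Sum>i. ennreal (diam_pow h (V i))) \<le> hausdorff_pre h \<delta> B + ennreal (e / 2)"
    using approx by metis
  define W where "W i = (if even i then U (i div 2) else V (i div 2))" for i
  have "U i = W (2 * i)" "V i = W (2 * i + 1)" for i
    by (auto simp: W_def)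
  then have "(\<Union>i. U i) \<union> (\<Union>i. V i) \<subseteq> (\<Union>i. W i)" by blast
  moreover have "bounded (W i) \<and> diameter (W i) \<le> \<delta>" for i
    using U(1) V(1) by (auto simp: W_def delta_cover_def)
  ultimately have "delta_cover \<delta> (A \<union> B) W"
    using U(1) V(1) unfolding delta_cover_def by blast
  then have "hausdorff_pre h \<delta> (A \<union> B) \<le> (\<Sum>i. ennreal (diam_pow h (W i)))"
    by (rule hausdorff_pre_le)
  also have "\<dots> = (\<Sum>i. if even i then ennreal (diam_pow h (U (i div 2)))
      else ennreal (diam_pow h (V (i div 2))))"
    by (intro suminf_cong) (auto simp: W_def)
  also have "\<dots> \<le> (\<Sum>i. ennreal (diam_pow h (U i))) + (\<Sum>i. ennreal (diam_pow h (V i)))"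
    by (rule suminf_interleave_le)
  also have "\<dots> \<le> (hausdorff_pre h \<delta> A + ennreal (e / 2)) + (hausdorff_pre h \<delta> B + ennreal (e / 2))"
    by (intro add_mono U V)
  also have "\<dots> = hausdorff_pre h \<delta> A + hausdorff_pre h \<delta> B + (ennreal (e / 2) + ennreal (e / 2))"
    by (simp add: add_ac)
  also have "ennreal (e / 2) + ennreal (e / 2) = ennreal e"
    using e by (subst ennreal_plus[symmetric]) auto
  finally show "hausdorff_pre h \<delta> (A \<union> B) \<le> hausdorff_pre h \<delta> A + hausdorff_pre h \<delta> B + ennreal e" .
qed

lemma hausdorff_pre_UN:
  assumes "finite I" "0 \<le> \<delta>"
  shows "hausdorff_pre h \<delta> (\<Union>j\<in>I. A j) \<le> (\<Sum>j\<in>I. hausdorff_pre h \<delta> (A j))"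
  using assms(1)
proof (induction I rule: finite_induct)
  case empty
  show ?case
    using hausdorff_pre_le_diam_pow[of "{}" \<delta> "{}" h] assms(2)
    by (simp add: diam_pow_def diameter_empty)
next
  case (insert j I)
  have "hausdorff_pre h \<delta> (\<Union>j\<in>insert j I. A j) \<le>
      hausdorff_pre h \<delta> (A j) + hausdorff_pre h \<delta> (\<Union>j\<in>I. A j)"
    unfolding UN_insert by (rule hausdorff_pre_Un)
  also have "\<dots> \<le> hausdorff_pre h \<delta> (A j) + (\<Sum>j\<in>I. hausdorff_pre h \<delta> (A j))"
    by (intro add_left_mono insert.IH)
  finally show ?case using insert.hyps by simp
qed

lemma hausdorff_pre_similarity:
  fixes f :: "'a::metric_space \<Rightarrow> 'b::metric_space"
  assumes h: "0 \<le> h" and c: "0 < c" and f: "\<And>x y. dist (f x) (f y) = c * dist x y"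
  shows "hausdorff_pre h (c * \<delta>) (f ` A) \<le> ennreal (c powr h) * hausdorff_pre h \<delta> A"
proof -
  have bounded_image: "bounded (f ` V)" if "bounded V" for V
  proof -
    obtain a r where "\<forall>x\<in>V. dist a x \<le> r" using \<open>bounded V\<close> unfolding bounded_def by blast
    then have "\<forall>y\<in>f ` V. dist (f a) y \<le> c * r" using c f by auto
    then show ?thesis unfolding bounded_def by blast
  qed
  have diameter_image: "diameter (f ` V) \<le> c * diameter V" if "bounded V" for V
  proof (cases "V = {}")
    case False
    have "dist x y \<le> c * diameter V" if xy: "x \<in> f ` V" "y \<in> f ` V" for x y
      using xy c f diameter_bounded_bound[OF \<open>bounded V\<close>] by auto
    then show ?thesis using False by (auto simp: diameter_def intro!: cSUP_least)
  qed (simp add: diameter_empty)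
  have "hausdorff_pre h (c * \<delta>) (f ` A) / ennreal (c powr h) \<le> hausdorff_pre h \<delta> A"
  proof (rule hausdorff_pre_greatest, rule divide_le_posI_ennreal)
    fix U assume U: "delta_cover \<delta> A U"
    have "delta_cover (c * \<delta>) (f ` A) (\<lambda>i. f ` U i)"
      unfolding delta_cover_def
    proof (intro conjI allI)
      show "f ` A \<subseteq> (\<Union>i. f ` U i)" using U unfolding delta_cover_def by blast
      fix i
      have "bounded (U i)" "diameter (U i) \<le> \<delta>" using U unfolding delta_cover_def by auto
      then show "bounded (f ` U i)" "diameter (f ` U i) \<le> c * \<delta>"
        using bounded_image diameter_image[of "U i"] c
        by (auto intro: order_trans mult_left_mono)
    qed
    then have "hausdorff_pre h (c * \<delta>) (f ` A) \<le> (\<Sum>i. ennreal (diam_pow h (f ` U i)))"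
      by (rule hausdorff_pre_le)
    also have "\<dots> \<le> (\<Sum>i. ennreal (c powr h) * ennreal (diam_pow h (U i)))"
    proof (intro suminf_le allI)
      fix i
      have b: "bounded (U i)" using U unfolding delta_cover_def by auto
      have "diam_pow h (f ` U i) \<le> c powr h * diam_pow h (U i)"
      proof (cases "U i = {} \<or> h = 0")
        case False
        have "diameter (f ` U i) powr h \<le> (c * diameter (U i)) powr h"
          using b bounded_image diameter_image h
          by (intro powr_mono2) (auto simp: diameter_ge_0)
        then show ?thesis
          using False b c by (simp add: diam_pow_def powr_mult diameter_ge_0)
      qed (use c in \<open>auto simp: diam_pow_def\<close>)
      then show "ennreal (diam_pow h (f ` U i)) \<le> ennreal (c powr h) * ennreal (diam_pow h (U i))"
        by (simp add: ennreal_mult'[symmetric] ennreal_leI)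
    qed auto
    finally show "hausdorff_pre h (c * \<delta>) (f ` A) \<le>
        ennreal (c powr h) * (\<Sum>i. ennreal (diam_pow h (U i)))"
      by simp
  qed (use c in auto)
  then have "hausdorff_pre h (c * \<delta>) (f ` A) / ennreal (c powr h) * ennreal (c powr h) \<le>
      hausdorff_pre h \<delta> A * ennreal (c powr h)"
    by (rule mult_right_mono) simp
  also have "hausdorff_pre h (c * \<delta>) (f ` A) / ennreal (c powr h) * ennreal (c powr h) =
      hausdorff_pre h (c * \<delta>) (f ` A)"
    using c unfolding ennreal_divide_times by (subst ennreal_divide_self) auto
  finally show ?thesis by (simp only: mult.commute)
qed


lemma hausdorff_pre_le_measure: "0 < \<delta> \<Longrightarrow> hausdorff_pre h \<delta> A \<le> hausdorff_measure h A"
  unfolding hausdorff_measure_eq_SUP by (rule SUP_upper) simp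

lemma hausdorff_measure_leI:
  assumes "\<And>k. hausdorff_pre h ((1 / 2) ^ k) A \<le> c"
  shows "hausdorff_measure h A \<le> c"
  unfolding hausdorff_measure_eq_SUP
proof (rule SUP_least)
  fix \<delta> :: real assume "\<delta> \<in> {0<..}"
  then obtain k where "(1 / 2) ^ k < \<delta>"
    using real_arch_pow_inv[of \<delta> "1 / 2"] by auto
  then have "hausdorff_pre h \<delta> A \<le> hausdorff_pre h ((1 / 2) ^ k) A"
    by (intro hausdorff_pre_antimono) simp
  then show "hausdorff_pre h \<delta> A \<le> c" using assms order_trans by blast
qed

lemma diam_pow_antimono:
  assumes "0 \<le> s" "s \<le> t" "bounded U" "diameter U \<le> 1"
  shows "diam_pow t U \<le> diam_pow s U"
proof (cases "U = {} \<or> s = 0")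
  case True
  have "diameter U powr t \<le> 1"
    using assms by (intro powr_le1) (auto simp: diameter_ge_0)
  then show ?thesis using True assms by (auto simp: diam_pow_def)
next
  case False
  then show ?thesis
    using assms by (auto simp: diam_pow_def diameter_ge_0 intro!: powr_mono')
qed

text \<open>On scales at most 1 a larger exponent makes all covering sums smaller.\<close>

lemma hausdorff_pre_exponent_antimono:
  assumes "0 \<le> s" "s \<le> t" "\<delta> \<le> 1"
  shows "hausdorff_pre t \<delta> A \<le> hausdorff_pre s \<delta> A"
proof (rule hausdorff_pre_greatest)
  fix U assume U: "delta_cover \<delta> A U"
  have "hausdorff_pre t \<delta> A \<le> (\<Sum>i. ennreal (diam_pow t (U i)))"
    using U by (rule hausdorff_pre_le)
  also have "\<dots> \<le> (\<Sum>i. ennreal (diam_pow s (U i)))"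
    using U assms by (intro suminf_le allI ennreal_leI diam_pow_antimono)
      (auto simp: delta_cover_def intro: order_trans)
  finally show "hausdorff_pre t \<delta> A \<le> (\<Sum>i. ennreal (diam_pow s (U i)))" .
qed

text \<open>Arbitrary covering sets are replaced by slightly longer open intervals. These admit finite subcovers,
  and their mass can be estimated.\<close>

lemma subset_thickened_interval:
  fixes U :: "real set"
  assumes "bounded U" "0 < \<eta>"
  obtains a b where "a < b" "U \<subseteq> {a<..<b}" "b - a \<le> diameter U + 2 * \<eta>"
proof (cases "U = {}")
  case True
  show ?thesis by (rule that[of 0 \<eta>]) (use True assms in \<open>auto simp: diameter_empty\<close>)
next
  case False
  have "bdd_below U" "bdd_above U"
    using assms by (auto simp: bounded_imp_bdd_below bounded_imp_bdd_above)
  then have mem: "Inf U \<le> x" "x \<le> Sup U" if "x \<in> U" for x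
    using that by (auto intro: cInf_lower cSup_upper)
  have "x \<le> Inf U + diameter U" if "x \<in> U" for x
  proof -
    have "x - diameter U \<le> Inf U"
    proof (rule cInf_greatest[OF False])
      fix y assume "y \<in> U"
      then have "dist x y \<le> diameter U" by (intro diameter_bounded_bound assms that)
      then show "x - diameter U \<le> y" by (simp add: dist_real_def)
    qed
    then show ?thesis by simp
  qed
  then have "Sup U \<le> Inf U + diameter U" by (intro cSup_least False)
  moreover obtain x where "x \<in> U" using False by blast
  then have "Inf U \<le> Sup U" using mem[of x] by linarith
  ultimately show ?thesis
  proof (intro that[of "Inf U - \<eta>" "Sup U + \<eta>"])
    show "U \<subseteq> {Inf U - \<eta><..<Sup U + \<eta>}"
    proof
      fix x assume "x \<in> U"
      then show "x \<in> {Inf U - \<eta><..<Sup U + \<eta>}" using mem[of x] assms by simp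
    qed
  qed (use assms in auto)
qed

section \<open>Hausdorff measures of the limit set\<close>

lemma hausdorff_pre_gauss_inv:
  assumes "j \<in> {1..n}" "0 \<le> s" "0 \<le> \<delta>"
  shows "hausdorff_pre s (\<delta> / 2) (gauss_inv j ` A) \<le> ennreal (contraction j powr s) * hausdorff_pre s \<delta> A"
proof -
  have j: "1 \<le> j" using assms by simp
  have "contraction j * \<delta> \<le> 1 / 2 * \<delta>"
    using contraction_le_half[OF j] assms by (intro mult_right_mono)
  then have "hausdorff_pre s (\<delta> / 2) (gauss_inv j ` A) \<le> hausdorff_pre s (contraction j * \<delta>) (gauss_inv j ` A)"
    by (intro hausdorff_pre_antimono) simp
  also have "\<dots> \<le> ennreal (contraction j powr s) * hausdorff_pre s \<delta> A"
    using assms contraction_pos[OF j] dist_gauss_inv[OF j] by (intro hausdorff_pre_similarity)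
  finally show ?thesis .
qed

text \<open>Scaled copies of a cover of the limit set on the scale \<open>\<delta>\<close>, one for each branch, cover it on the scale
  \<open>\<delta>/2\<close>. When \<open>\<Sum> r\<^sub>j\<^sup>s = 1\<close> the premeasure is consequently the same on all scales at most 1, and the Hausdorff
  measure is the premeasure on scale 1; when the sum is smaller than 1 the measure vanishes.\<close>

lemma hausdorff_pre_limit_set_half:
  assumes "0 \<le> s" "0 \<le> \<delta>"
  shows "hausdorff_pre s (\<delta> / 2) (limit_set n) \<le>
    ennreal (\<Sum>j=1..n. contraction j powr s) * hausdorff_pre s \<delta> (limit_set n)"
proof -
  have "hausdorff_pre s (\<delta> / 2) (limit_set n) \<le>
      hausdorff_pre s (\<delta> / 2) (\<Union>j\<in>{1..n}. gauss_inv j ` limit_set n)"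
    by (rule hausdorff_pre_subset[OF limit_set_subset_UN])
  also have "\<dots> \<le> (\<Sum>j=1..n. hausdorff_pre s (\<delta> / 2) (gauss_inv j ` limit_set n))"
    using assms by (intro hausdorff_pre_UN) auto
  also have "\<dots> \<le> (\<Sum>j=1..n. ennreal (contraction j powr s) * hausdorff_pre s \<delta> (limit_set n))"
    using assms by (intro sum_mono hausdorff_pre_gauss_inv[where n = n]) auto
  also have "\<dots> = ennreal (\<Sum>j=1..n. contraction j powr s) * hausdorff_pre s \<delta> (limit_set n)"
    by (simp add: sum_distrib_right[symmetric] sum_ennreal)
  finally show ?thesis .
qed

lemma hausdorff_pre_limit_set_le_1:
  assumes "0 \<le> s"
  shows "hausdorff_pre s 1 (limit_set n) \<le> 1"
proof -
  have "hausdorff_pre s 1 (limit_set n) \<le> ennreal (diam_pow s {0..1::real})"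
    using limit_set_subset by (intro hausdorff_pre_le_diam_pow) auto
  moreover have "diameter {0..1::real} = 1" using diameter_closed_interval[of 0 1] by simp
  ultimately show ?thesis by (simp add: diam_pow_def split: if_splits)
qed

lemma hausdorff_measure_limit_set_le:
  assumes "0 \<le> s" "(\<Sum>j=1..n. contraction j powr s) \<le> 1"
  shows "hausdorff_measure s (limit_set n) \<le> hausdorff_pre s 1 (limit_set n)"
proof (rule hausdorff_measure_leI)
  fix k
  show "hausdorff_pre s ((1 / 2) ^ k) (limit_set n) \<le> hausdorff_pre s 1 (limit_set n)"
  proof (induction k)
    case (Suc k)
    have "hausdorff_pre s ((1 / 2) ^ k / 2) (limit_set n) \<le>
        ennreal (\<Sum>j=1..n. contraction j powr s) * hausdorff_pre s ((1 / 2) ^ k) (limit_set n)"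
      using assms(1) by (intro hausdorff_pre_limit_set_half) auto
    also have "\<dots> \<le> ennreal 1 * hausdorff_pre s ((1 / 2) ^ k) (limit_set n)"
      using assms(2) by (intro mult_right_mono ennreal_leI) auto
    also have "\<dots> \<le> hausdorff_pre s 1 (limit_set n)" using Suc by simp
    finally show ?case by (simp add: mult.commute)
  qed simp
qed

lemma hausdorff_measure_limit_set_eq_0:
  assumes "0 \<le> s" "(\<Sum>j=1..n. contraction j powr s) < 1"
  shows "hausdorff_measure s (limit_set n) = 0"
proof -
  define q where "q = (\<Sum>j=1..n. contraction j powr s)"
  have q: "0 \<le> q" "q < 1" using assms by (auto simp: q_def intro!: sum_nonneg)
  let ?x = "hausdorff_pre s 1 (limit_set n)"
  have "?x < top"
    by (rule le_less_trans[OF hausdorff_pre_limit_set_le_1[OF assms(1)] ennreal_one_less_top])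
  then obtain x where x: "?x = ennreal x" "0 \<le> x" by (cases ?x) auto
  have "?x \<le> hausdorff_pre s (1 / 2) (limit_set n)" by (rule hausdorff_pre_antimono) simp
  also have "\<dots> \<le> ennreal q * ?x"
    unfolding q_def using assms(1) by (intro hausdorff_pre_limit_set_half) auto
  finally have "x \<le> q * x" using x q by (simp add: ennreal_mult'[symmetric])
  then have "x * (1 - q) \<le> 0" by (simp add: algebra_simps)
  then have "x = 0" using x q by (simp add: mult_le_0_iff)
  then show ?thesis using hausdorff_measure_limit_set_le[of s n] assms x by simp
qed

section \<open>The self-similar mass\<close>

text \<open>The sum of \<open>r\<^sub>\<omega>\<^sup>h\<close> over the words \<open>\<omega>\<close> of length \<open>k\<close> with \<open>g\<^sub>\<omega>([0,1])\<close> meeting \<open>U\<close>. Recursion over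
  preimages avoids words and builds in the self-similarity.\<close>

primrec cylinder_mass :: "nat \<Rightarrow> real \<Rightarrow> nat \<Rightarrow> real set \<Rightarrow> real" where
  "cylinder_mass n h 0 U = (if U \<inter> {0..1} = {} then 0 else 1)"
| "cylinder_mass n h (Suc k) U =
    (\<Sum>j=1..n. contraction j powr h * cylinder_mass n h k (gauss_inv j -` U))"

lemma cylinder_mass_nonneg: "0 \<le> cylinder_mass n h k U"
  by (induction k arbitrary: U) (auto intro!: sum_nonneg)

lemma cylinder_mass_mono: "U \<subseteq> V \<Longrightarrow> cylinder_mass n h k U \<le> cylinder_mass n h k V"
proof (induction k arbitrary: U V)
  case (Suc k)
  then show ?case unfolding cylinder_mass.simps
    by (intro sum_mono mult_left_mono Suc.IH powr_ge_zero vimage_mono)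
qed auto

lemma cylinder_mass_Un: "cylinder_mass n h k (U \<union> V) \<le> cylinder_mass n h k U + cylinder_mass n h k V"
proof (induction k arbitrary: U V)
  case (Suc k)
  have "cylinder_mass n h (Suc k) (U \<union> V) \<le> (\<Sum>j=1..n. contraction j powr h *
      (cylinder_mass n h k (gauss_inv j -` U) + cylinder_mass n h k (gauss_inv j -` V)))"
    unfolding cylinder_mass.simps vimage_Un by (intro sum_mono mult_left_mono Suc.IH powr_ge_zero)
  then show ?case by (simp add: distrib_left sum.distrib)
qed auto

text \<open>The exponent \<open>h\<close> of Moran's equation, which is shown to be the Hausdorff dimension of the limit
  set. The condition on \<open>n\<close> keeps it positive.\<close>

locale truncated_gauss =
  fixes n :: nat and h :: real
  assumes n_ge: "2 \<le> n" and h_pos: "0 < h" and h_less: "h < 1"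
    and sum_powr: "(\<Sum>j=1..n. contraction j powr h) = 1"
begin

lemma cylinder_mass_antimono: "cylinder_mass n h (Suc k) U \<le> cylinder_mass n h k U"
proof (induction k arbitrary: U)
  case 0
  show ?case
  proof (cases "U \<inter> {0..1} = {}")
    case True
    have "gauss_inv j -` U \<inter> {0..1} = {}" if "j \<in> {1..n}" for j
      using True that gauss_inv_unit[of j] by auto
    then show ?thesis using True by simp
  next
    case False
    have "cylinder_mass n h (Suc 0) U \<le> (\<Sum>j=1..n. contraction j powr h)"
      by (auto intro!: sum_mono)
    then show ?thesis using False by (simp only: sum_powr) auto
  qed
next
  case (Suc k)
  show ?case
    by (subst (1 2) cylinder_mass.simps(2)) (intro sum_mono mult_left_mono Suc.IH powr_ge_zero)
qed

text \<open>Every preimage under a branch of a set containing the limit set again contains the limit set.\<close>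

lemma cylinder_mass_ge_1:
  assumes "limit_set n \<subseteq> U"
  shows "1 \<le> cylinder_mass n h k U"
  using assms
proof (induction k arbitrary: U)
  case 0
  then show ?case
    using two_thirds_in_limit_set[of n] limit_set_subset[of n] n_ge by auto
next
  case (Suc k)
  have "contraction j powr h * 1 \<le> contraction j powr h * cylinder_mass n h k (gauss_inv j -` U)"
    if "j \<in> {1..n}" for j
    using Suc.prems gauss_inv_limit_set[OF that] by (intro mult_left_mono Suc.IH) auto
  then have "(\<Sum>j=1..n. contraction j powr h * 1) \<le> cylinder_mass n h (Suc k) U"
    unfolding cylinder_mass.simps by (rule sum_mono)
  then show ?case by (simp only: mult_1_right sum_powr)
qed

text \<open>Not a measure on all sets, but monotone, finitely subadditive and self-similar, which is all that the
  mass distribution principle needs. On open intervals, endpoints shared by two cylinders cause no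
  double counting.\<close>

definition mass :: "real set \<Rightarrow> real" where
  "mass U = lim (\<lambda>k. cylinder_mass n h k U)"

lemma cylinder_mass_tendsto: "(\<lambda>k. cylinder_mass n h k U) \<longlonglongrightarrow> mass U"
proof -
  have "decseq (\<lambda>k. cylinder_mass n h k U)"
    by (rule decseq_SucI) (rule cylinder_mass_antimono)
  then have "convergent (\<lambda>k. cylinder_mass n h k U)"
    using cylinder_mass_nonneg by (metis decseq_convergent convergentI)
  then show ?thesis by (simp add: mass_def convergent_LIMSEQ_iff)
qed

lemma mass_nonneg: "0 \<le> mass U"
  using cylinder_mass_tendsto cylinder_mass_nonneg by (meson LIMSEQ_le_const)

lemma mass_mono: "U \<subseteq> V \<Longrightarrow> mass U \<le> mass V"
  using cylinder_mass_tendsto cylinder_mass_mono by (meson LIMSEQ_le)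

lemma mass_Un: "mass (U \<union> V) \<le> mass U + mass V"
  using LIMSEQ_le[OF cylinder_mass_tendsto tendsto_add[OF cylinder_mass_tendsto cylinder_mass_tendsto]]
    cylinder_mass_Un by blast

lemma mass_le_1: "mass U \<le> 1"
proof -
  have "cylinder_mass n h k U \<le> 1" for k
    using cylinder_mass_antimono[of _ U]
    by (induction k) (auto intro: order_trans simp del: cylinder_mass.simps(2))
  then show ?thesis using cylinder_mass_tendsto by (meson LIMSEQ_le_const2)
qed

lemma mass_ge_1: "limit_set n \<subseteq> U \<Longrightarrow> 1 \<le> mass U"
  using cylinder_mass_tendsto cylinder_mass_ge_1 by (meson LIMSEQ_le_const)

lemma mass_eq_0:
  assumes "U \<inter> {0..1} = {}"
  shows "mass U = 0"
proof -
  have "mass U \<le> cylinder_mass n h 0 U"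
    using cylinder_mass_tendsto
    by (rule decseq_ge[rotated]) (rule decseq_SucI, rule cylinder_mass_antimono)
  then show ?thesis using assms mass_nonneg[of U] by simp
qed

lemma mass_rec: "mass U = (\<Sum>j=1..n. contraction j powr h * mass (gauss_inv j -` U))"
proof (rule LIMSEQ_unique)
  show "(\<lambda>k. cylinder_mass n h (Suc k) U) \<longlonglongrightarrow> mass U"
    by (rule LIMSEQ_Suc[OF cylinder_mass_tendsto])
  show "(\<lambda>k. cylinder_mass n h (Suc k) U) \<longlonglongrightarrow>
      (\<Sum>j=1..n. contraction j powr h * mass (gauss_inv j -` U))"
    unfolding cylinder_mass.simps by (intro tendsto_intros cylinder_mass_tendsto)
qed

section \<open>Mass of intervals\<close>

lemma mass_lessThan_eq_0: "s \<le> 0 \<Longrightarrow> mass {..<s} = 0"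
  by (rule mass_eq_0) auto

lemma mass_greaterThan_eq_0: "1 \<le> t \<Longrightarrow> mass {t<..} = 0"
  by (rule mass_eq_0) auto

text \<open>Bound for the ratio of \<open>mass(F)\<close> to \<open>|F|\<^sup>h\<close> when \<open>F\<close> is composed of complete first-level pieces.\<close>

definition full_const :: real where
  "full_const = real n powr (1 - h)"

lemma full_const_ge_1: "1 \<le> full_const"
  using n_ge h_less by (simp add: full_const_def ge_one_powr_ge_zero)

lemma sum_contraction_powr_le:
  assumes "1 \<le> a" "a \<le> b" "b \<le> n + 1"
  shows "(\<Sum>j=a..<b. contraction j powr h) \<le> full_const * (1 / real a - 1 / real b) powr h"
proof -
  have "(\<Sum>j=a..<b. contraction j powr h) \<le>
      real (card {a..<b}) powr (1 - h) * (\<Sum>j=a..<b. contraction j) powr h"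
    using assms h_pos h_less less_imp_le[OF contraction_pos]
    by (intro sum_powr_le_card_powr) auto
  also have "\<dots> \<le> full_const * (\<Sum>j=a..<b. contraction j) powr h"
    unfolding full_const_def using assms h_less by (intro mult_right_mono powr_mono2) auto
  finally show ?thesis using assms by (simp add: sum_contraction)
qed

lemma mass_le_sum:
  assumes "1 \<le> a" "b \<le> n + 1"
    and "\<And>j. 1 \<le> j \<Longrightarrow> j \<le> n \<Longrightarrow> j < a \<or> b \<le> j \<Longrightarrow> mass (gauss_inv j -` U) = 0"
  shows "mass U \<le> (\<Sum>j=a..<b. contraction j powr h)"
proof -
  have "mass U = (\<Sum>j=a..<b. contraction j powr h * mass (gauss_inv j -` U))"
    unfolding mass_rec[of U]
    by (rule sum.mono_neutral_right) (use assms in \<open>auto simp: not_less\<close>)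
  also have "\<dots> \<le> (\<Sum>j=a..<b. contraction j powr h)"
    by (intro sum_mono mult_left_le mass_le_1 powr_ge_zero)
  finally show ?thesis .
qed

lemma mass_le_sum_insert:
  assumes "1 \<le> a" "b \<le> n + 1" "1 \<le> l" "l \<le> n" "l \<notin> {a..<b}"
    and "\<And>j. 1 \<le> j \<Longrightarrow> j \<le> n \<Longrightarrow> j < a \<or> b \<le> j \<Longrightarrow> j \<noteq> l \<Longrightarrow> mass (gauss_inv j -` U) = 0"
  shows "mass U \<le> contraction l powr h * mass (gauss_inv l -` U) + (\<Sum>j=a..<b. contraction j powr h)"
proof -
  have "mass U = (\<Sum>j\<in>insert l {a..<b}. contraction j powr h * mass (gauss_inv j -` U))"
    unfolding mass_rec[of U]
    by (rule sum.mono_neutral_right) (use assms in \<open>auto simp: not_less\<close>)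
  also have "\<dots> = contraction l powr h * mass (gauss_inv l -` U)
      + (\<Sum>j=a..<b. contraction j powr h * mass (gauss_inv j -` U))"
    using assms(5) by simp
  also have "(\<Sum>j=a..<b. contraction j powr h * mass (gauss_inv j -` U)) \<le> (\<Sum>j=a..<b. contraction j powr h)"
    by (intro sum_mono mult_left_le mass_le_1 powr_ge_zero)
  finally show ?thesis by simp
qed

text \<open>The interval \<open>[0, 1/(n+1))\<close> is a gap of the limit set.\<close>

lemma mass_lessThan_gap:
  assumes "s \<le> 1 / (real n + 1)"
  shows "mass {..<s} = 0"
proof -
  have "mass {..<s} \<le> (\<Sum>j=1..<1. contraction j powr h)"
  proof (rule mass_le_sum)
    fix j assume j: "1 \<le> j" "j \<le> n"
    have "s \<le> 1 / (real j + 1)"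
      using assms j by (smt (verit) frac_le of_nat_le_iff of_nat_0_le_iff)
    then show "mass (gauss_inv j -` {..<s}) = 0"
      using j by (simp add: vimage_gauss_inv gauss_branch_ge_1 mass_greaterThan_eq_0)
  qed auto
  then show ?thesis using mass_nonneg[of "{..<s}"] by simp
qed

text \<open>A common bound for the ratio of mass to \<open>h\<close>-th power of the length for the end intervals \<open>[0,s)\<close> and
  \<open>(1-s,1]\<close>.\<close>

definition end_bound :: "real \<Rightarrow> bool" where
  "end_bound K \<longleftrightarrow> (\<forall>s\<ge>0. mass {..<s} \<le> K * s powr h) \<and> (\<forall>s\<ge>0. mass {1 - s<..} \<le> K * s powr h)"

text \<open>Suppose \<open>s\<close> lies in the \<open>l\<close>-th piece. Then \<open>[0,s)\<close> consists of \<open>[0, 1/(l+1))\<close>, which carries only complete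
  pieces, and of a part of the \<open>l\<close>-th piece; the latter has length at most \<open>1/(l(l+1)) \<le> 1/(l+1)\<close>. So it
  is the shorter part, and \<open>weighted_powr_add_le\<close> applies.\<close>

lemma mass_lessThan_le_improved:
  assumes K: "end_bound K" "full_const \<le> K" and s: "0 \<le> s"
  shows "mass {..<s} \<le> (K + full_const) / 2 powr h * s powr h"
proof -
  let ?K = "(K + full_const) / 2 powr h"
  have K1: "1 \<le> K" using K full_const_ge_1 by simp
  have "2 powr h \<le> (2::real) powr 1" using h_less by (intro powr_mono) auto
  then have K2: "1 \<le> ?K" using K1 full_const_ge_1 by (simp add: field_simps)
  consider "s \<le> 1 / (real n + 1)" | "1 < s" | "1 / (real n + 1) < s" "s \<le> 1" by linarith
  then show ?thesis
  proof cases
    case 1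
    have "0 \<le> ?K * s powr h" using K2 by (intro mult_nonneg_nonneg powr_ge_zero) linarith
    then show ?thesis unfolding mass_lessThan_gap[OF 1] .
  next
    case 2
    have "1 * 1 \<le> ?K * s powr h"
    proof (rule mult_mono)
      show "1 \<le> s powr h" using 2 h_pos by (simp add: ge_one_powr_ge_zero)
    qed (use K2 in linarith)+
    then show ?thesis using mass_le_1[of "{..<s}"] by linarith
  next
    case 3
    then have "0 < s" by (smt (verit) divide_nonneg_nonneg of_nat_0_le_iff)
    then obtain l where l: "1 \<le> l" "1 / (real l + 1) < s" "s \<le> 1 / real l"
      using 3 exists_reciprocal_interval by blast
    have ln: "l \<le> n"
    proof (rule ccontr)
      assume "\<not> l \<le> n"
      then have "1 / real l \<le> 1 / (real n + 1)" using n_ge by (intro reciprocal_le) auto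
      then show False using l 3 by linarith
    qed
    let ?v = "1 / real (Suc l)" and ?u = "s - 1 / real (Suc l)"
    have "mass {..<s} \<le> contraction l powr h * mass (gauss_inv l -` {..<s}) +
        (\<Sum>j=Suc l..<n + 1. contraction j powr h)"
    proof (rule mass_le_sum_insert)
      fix j assume j: "1 \<le> j" "j \<le> n" "j < Suc l \<or> n + 1 \<le> j" "j \<noteq> l"
      then have "s \<le> 1 / (real j + 1)" using l reciprocal_le[of j l] by auto
      then show "mass (gauss_inv j -` {..<s}) = 0"
        using j by (simp add: vimage_gauss_inv gauss_branch_ge_1 mass_greaterThan_eq_0)
    qed (use l ln in auto)
    also have "\<dots> \<le> K * ?u powr h + full_const * ?v powr h"
    proof (rule add_mono)
      have u: "0 \<le> ?u" using l by (simp add: add.commute)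
      have "1 - ?u / contraction l = gauss_branch l s"
        using one_minus_gauss_branch[of l s] l by (simp add: add.commute)
      then have "mass {gauss_branch l s<..} \<le> K * (?u / contraction l) powr h"
        using K(1) u contraction_pos[of l] l unfolding end_bound_def
        by (metis divide_nonneg_pos)
      then show "contraction l powr h * mass (gauss_inv l -` {..<s}) \<le> K * ?u powr h"
        using l ln u by (intro contraction_powr_mult_le) (auto simp: vimage_gauss_inv)
      have "(\<Sum>j=Suc l..<n + 1. contraction j powr h) \<le> full_const * (1 / real (Suc l) - 1 / real (n + 1)) powr h"
        using ln by (intro sum_contraction_powr_le) auto
      also have "\<dots> \<le> full_const * ?v powr h"
        using ln full_const_ge_1 h_pos by (intro mult_left_mono powr_mono2) (auto simp: frac_le)
      finally show "(\<Sum>j=Suc l..<n + 1. contraction j powr h) \<le> full_const * ?v powr h" .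
    qed
    also have "\<dots> \<le> ?K * (?u + ?v) powr h"
    proof (rule weighted_powr_add_le)
      have "1 * (real l + 1) \<le> real l * (real l + 1)" using l(1) by (intro mult_right_mono) auto
      then have "contraction l \<le> 1 / (real l + 1)"
        unfolding contraction_def by (intro frac_le) auto
      then have "1 / real l - 1 / (real l + 1) \<le> 1 / (real l + 1)"
        using contraction_eq[OF l(1)] by simp
      then show "?u \<le> ?v" using l by (simp add: add.commute)
    qed (use l K full_const_ge_1 h_pos h_less in \<open>auto simp: add.commute\<close>)
    finally show ?thesis by simp
  qed
qed

text \<open>If \<open>1 - s\<close> lies in the \<open>l\<close>-th piece with \<open>l \<ge> 2\<close>, the complete pieces make up \<open>[1/l, 1]\<close>, of length at
  least \<open>1/2\<close>, and the incomplete piece is the shorter part. If \<open>l = 1\<close>, the interval is a copy of an interval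
  \<open>[0,s')\<close> and inherits the improved bound for those.\<close>

lemma mass_greaterThan_le_improved:
  assumes K: "end_bound K" "full_const \<le> K" and s: "0 \<le> s"
  shows "mass {1 - s<..} \<le> (K + full_const) / 2 powr h * s powr h"
proof -
  let ?K = "(K + full_const) / 2 powr h"
  have K1: "1 \<le> K" using K full_const_ge_1 by simp
  have p2: "2 powr h \<le> (2::real) powr 1" using h_less by (intro powr_mono) auto
  then have K2: "1 \<le> ?K" using K1 full_const_ge_1 by (simp add: field_simps)
  have K3: "full_const \<le> ?K"
  proof -
    have "full_const * 2 powr h \<le> full_const * 2" using p2 full_const_ge_1 by (intro mult_left_mono) auto
    then show ?thesis using K by (simp add: field_simps)
  qed
  define t where "t = 1 - s"
  consider "1 \<le> t" | "t < 1 / (real n + 1)" | "1 / (real n + 1) \<le> t" "t < 1" by linarith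
  then show ?thesis
  proof cases
    case 1
    have "0 \<le> ?K * s powr h" using K2 by (intro mult_nonneg_nonneg powr_ge_zero) linarith
    then show ?thesis using mass_greaterThan_eq_0[OF 1] by (simp add: t_def)
  next
    case 2
    have "mass {1 - s<..} \<le> (\<Sum>j=1..<n + 1. contraction j powr h)"
      by (rule mass_le_sum) auto
    also have "\<dots> \<le> full_const * (1 / real 1 - 1 / real (n + 1)) powr h"
      by (rule sum_contraction_powr_le) auto
    also have "\<dots> \<le> ?K * s powr h"
      using 2 K3 full_const_ge_1 h_pos
      by (intro mult_mono powr_mono2) (auto simp: t_def add.commute)
    finally show ?thesis .
  next
    case 3
    then have "0 < t" by (smt (verit) divide_pos_pos of_nat_0_le_iff)
    then obtain l where l: "1 \<le> l" "1 / (real l + 1) \<le> t" "t < 1 / real l"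
      using 3 exists_reciprocal_interval' by blast
    have ln: "l \<le> n"
    proof (rule ccontr)
      assume "\<not> l \<le> n"
      then have "1 / real l \<le> 1 / (real n + 1)" using n_ge by (intro reciprocal_le) auto
      then show False using l 3 by linarith
    qed
    let ?v = "1 / real 1 - 1 / real l" and ?u = "1 / real l - t"
    have u: "0 \<le> ?u" using l by simp
    have br: "gauss_branch l t = ?u / contraction l" using l by (simp add: gauss_branch_eq)
    have br0: "0 \<le> ?u / contraction l" using u contraction_pos[of l] l by simp
    have "mass {t<..} \<le> contraction l powr h * mass (gauss_inv l -` {t<..}) +
        (\<Sum>j=1..<l. contraction j powr h)"
    proof (rule mass_le_sum_insert)
      fix j assume j: "1 \<le> j" "j \<le> n" "j < 1 \<or> l \<le> j" "j \<noteq> l"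
      then have "1 / real j \<le> t" using l reciprocal_le[of l j] by auto
      then show "mass (gauss_inv j -` {t<..}) = 0"
        using j by (simp add: vimage_gauss_inv gauss_branch_le_0 mass_lessThan_eq_0)
    qed (use l ln in auto)
    also have "\<dots> \<le> ?K * s powr h"
    proof (cases "l = 1")
      case True
      have "mass {..<?u / contraction l} \<le> ?K * (?u / contraction l) powr h"
        by (rule mass_lessThan_le_improved[OF K br0])
      then have "contraction l powr h * mass (gauss_inv l -` {t<..}) \<le> ?K * ?u powr h"
        using l ln u br by (intro contraction_powr_mult_le) (auto simp: vimage_gauss_inv)
      then show ?thesis using True by (simp add: t_def)
    next
      case False
      have "contraction l powr h * mass (gauss_inv l -` {t<..}) + (\<Sum>j=1..<l. contraction j powr h)
          \<le> K * ?u powr h + full_const * ?v powr h"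
      proof (rule add_mono)
        have "mass {..<?u / contraction l} \<le> K * (?u / contraction l) powr h"
          using K(1) br0 unfolding end_bound_def by blast
        then show "contraction l powr h * mass (gauss_inv l -` {t<..}) \<le> K * ?u powr h"
          using l ln u br by (intro contraction_powr_mult_le) (auto simp: vimage_gauss_inv)
        show "(\<Sum>j=1..<l. contraction j powr h) \<le> full_const * ?v powr h"
          using l ln by (intro sum_contraction_powr_le) auto
      qed
      also have "\<dots> \<le> ?K * (?u + ?v) powr h"
      proof (rule weighted_powr_add_le)
        have "2 / real l \<le> 1" using l(1) False by simp
        then show "?u \<le> ?v" using \<open>0 < t\<close> by (simp add: field_simps)
      qed (use l K full_const_ge_1 h_pos h_less in auto)
      finally show ?thesis by (simp add: t_def)
    qed
    finally show ?thesis by (simp add: t_def)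
  qed
qed


text \<open>The fixed point of the improvement step \<open>K \<mapsto> (K + full_const)/2\<^sup>h\<close>.\<close>

definition end_const :: real where
  "end_const = full_const / (2 powr h - 1)"

lemma two_powr_h: "1 < 2 powr h" "2 powr h < 2"
  using powr_less_mono[of 0 h 2] powr_less_mono[of h 1 2] h_pos h_less by auto

lemma end_const_ge: "full_const \<le> end_const"
  using two_powr_h full_const_ge_1 by (simp add: end_const_def field_simps)

lemma end_bound_mono: "end_bound K \<Longrightarrow> K \<le> L \<Longrightarrow> end_bound L"
  unfolding end_bound_def by (meson mult_right_mono order_trans powr_ge_zero)

text \<open>Some finite bound is needed to start the improvement. It exists because both end intervals have mass at
  most 1, and carry no mass, or are copies of an interval \<open>[0,s')\<close>, when they are short.\<close>

lemma end_bound_crude: "end_bound (real n + 1)"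
proof -
  have large: "1 \<le> (real n + 1) * s powr h" if "1 / (real n + 1) < s" for s
  proof (cases "s \<le> 1")
    case True
    have "0 < s" using that by (smt (verit) divide_nonneg_nonneg of_nat_0_le_iff)
    then have "s powr 1 \<le> s powr h" using True h_less by (intro powr_mono') auto
    then have "(real n + 1) * s \<le> (real n + 1) * s powr h"
      using \<open>0 < s\<close> by (intro mult_left_mono) auto
    moreover have "1 < (real n + 1) * s" using that by (simp add: field_simps)
    ultimately show ?thesis by linarith
  next
    case False
    then have "1 * 1 \<le> (real n + 1) * s powr h"
      using h_pos by (intro mult_mono) (auto simp: ge_one_powr_ge_zero)
    then show ?thesis by simp
  qed
  have left: "mass {..<s} \<le> (real n + 1) * s powr h" for s
    using mass_lessThan_gap[of s] large[of s] mass_le_1[of "{..<s}"]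
    by (cases "s \<le> 1 / (real n + 1)") auto
  have right: "mass {1 - s<..} \<le> (real n + 1) * s powr h" if s: "0 \<le> s" for s
  proof (cases "s \<le> 1 / (real n + 1)")
    case False
    then show ?thesis using large[of s] mass_le_1[of "{1 - s<..}"] by simp
  next
    case True
    have "1 / (real n + 1) \<le> 1 / 2" using n_ge by (simp add: field_simps)
    then have s2: "1 / 2 \<le> 1 - s" using True by linarith
    have "mass {1 - s<..} \<le> contraction 1 powr h * mass (gauss_inv 1 -` {1 - s<..}) +
        (\<Sum>j=1..<1. contraction j powr h)"
    proof (rule mass_le_sum_insert)
      fix j assume j: "1 \<le> j" "j \<le> n" "j < 1 \<or> 1 \<le> j" "j \<noteq> 1"
      then have "1 / real j \<le> 1 / 2" by (intro frac_le) auto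
      then have "gauss_branch j (1 - s) \<le> 0"
        using j s2 by (intro gauss_branch_le_0) linarith+
      then show "mass (gauss_inv j -` {1 - s<..}) = 0"
        using j by (simp add: vimage_gauss_inv mass_lessThan_eq_0)
    qed (use n_ge in auto)
    also have "\<dots> = contraction 1 powr h * mass {..<s / contraction 1}"
      using n_ge by (simp add: vimage_gauss_inv gauss_branch_eq)
    also have "\<dots> \<le> (real n + 1) * s powr h"
      using s left by (intro contraction_powr_mult_le) auto
    finally show ?thesis .
  qed
  show ?thesis unfolding end_bound_def using left right by blast
qed

text \<open>Iterating the improvement from the crude bound converges to its fixed point.\<close>

lemma end_bound_end_const: "end_bound end_const"
proof -
  define q where "q = 1 / 2 powr h"
  have q: "0 < q" "q < 1" using two_powr_h by (auto simp: q_def)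
  have fixpoint: "(end_const + full_const) / 2 powr h = end_const"
  proof -
    define d where "d = 2 powr h - 1"
    have "2 powr h = d + 1" "0 < d" using two_powr_h by (auto simp: d_def)
    have "(full_const / d + full_const) / (d + 1) = full_const / d"
      using \<open>0 < d\<close> by (simp add: divide_simps) (simp add: algebra_simps)
    then show ?thesis unfolding end_const_def \<open>2 powr h = d + 1\<close> by simp
  qed
  \<comment> \<open>The deviation from the fixed point shrinks by the factor \<open>2\<^sup>-\<^sup>h\<close> in every step.\<close>
  have iter: "end_bound (end_const + (real n + 1) * q ^ i)" for i
  proof (induction i)
    case 0
    show ?case
      by (rule end_bound_mono[OF end_bound_crude]) (use end_const_ge full_const_ge_1 in auto)
  next
    case (Suc i)
    let ?K = "end_const + (real n + 1) * q ^ i"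
    have "full_const \<le> ?K" using end_const_ge q by (simp add: add_increasing2)
    then have "end_bound ((?K + full_const) / 2 powr h)"
      using mass_lessThan_le_improved[OF Suc] mass_greaterThan_le_improved[OF Suc]
      unfolding end_bound_def by blast
    moreover have "(?K + full_const) / 2 powr h = (end_const + full_const) / 2 powr h + (real n + 1) * q ^ Suc i"
      by (simp add: q_def add_divide_distrib)
    ultimately show ?case unfolding fixpoint by simp
  qed
  have "(\<lambda>i. (end_const + (real n + 1) * q ^ i) * s powr h) \<longlonglongrightarrow>
      (end_const + (real n + 1) * 0) * s powr h" for s
    using q by (intro tendsto_intros LIMSEQ_power_zero) auto
  then have lim: "(\<lambda>i. (end_const + (real n + 1) * q ^ i) * s powr h) \<longlonglongrightarrow> end_const * s powr h" for s
    by simp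
  show ?thesis
    unfolding end_bound_def
    using iter unfolding end_bound_def by (auto intro!: LIMSEQ_le_const[OF lim])
qed

definition interval_const :: real where
  "interval_const = 3 powr (1 - h) * end_const"

lemma interval_const_ge: "end_const \<le> interval_const" "1 \<le> end_const"
proof -
  show *: "1 \<le> end_const" using end_const_ge full_const_ge_1 by simp
  have "1 \<le> (3::real) powr (1 - h)" using h_less by (simp add: ge_one_powr_ge_zero)
  then have "1 * end_const \<le> interval_const"
    unfolding interval_const_def using * by (intro mult_right_mono) auto
  then show "end_const \<le> interval_const" by simp
qed

text \<open>To the left of the \<open>l\<close>-th piece, an interval starting at \<open>x\<close> contains complete pieces, of total length \<open>v\<close>, and at
  most one incomplete piece, of length \<open>w\<close>; there is none when \<open>x\<close> lies in the gap at 0.\<close>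

lemma mass_interval_rest:
  assumes l: "1 \<le> l" "l \<le> n" and x: "x < 1 / real (Suc l)"
  obtains v w where "0 \<le> v" "0 \<le> w" "v + w \<le> 1 / real (Suc l) - x"
    "(\<Sum>j=Suc l..<n + 1. contraction j powr h * mass (gauss_inv j -` {x<..<y}))
      \<le> end_const * v powr h + end_const * w powr h"
proof -
  let ?m = "\<lambda>j. contraction j powr h * mass (gauss_inv j -` {x<..<y})"
  have full: "(\<Sum>j=Suc l..<b. ?m j) \<le> end_const * (1 / real (Suc l) - 1 / real b) powr h"
    if "Suc l \<le> b" "b \<le> n + 1" for b
  proof -
    have "(\<Sum>j=Suc l..<b. ?m j) \<le> (\<Sum>j=Suc l..<b. contraction j powr h)"
      by (intro sum_mono mult_left_le mass_le_1 powr_ge_zero)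
    also have "\<dots> \<le> full_const * (1 / real (Suc l) - 1 / real b) powr h"
      using that by (intro sum_contraction_powr_le) auto
    also have "\<dots> \<le> end_const * (1 / real (Suc l) - 1 / real b) powr h"
      by (intro mult_right_mono end_const_ge) auto
    finally show ?thesis .
  qed
  show ?thesis
  proof (cases "x < 1 / (real n + 1)")
    case True
    show ?thesis
    proof (rule that)
      show "0 \<le> 1 / real (Suc l) - 1 / real (n + 1)" using l by (simp add: frac_le)
      show "1 / real (Suc l) - 1 / real (n + 1) + 0 \<le> 1 / real (Suc l) - x"
        using True by (simp add: add.commute)
      show "(\<Sum>j=Suc l..<n + 1. ?m j) \<le>
          end_const * (1 / real (Suc l) - 1 / real (n + 1)) powr h + end_const * 0 powr h"
        using full[of "n + 1"] l by simp
    qed simp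
  next
    case False
    have x0: "0 < x" using False by (smt (verit) divide_pos_pos of_nat_0_le_iff)
    have "1 / real (Suc l) \<le> 1" by simp
    then have "x < 1" using x by linarith
    then obtain b where b: "1 \<le> b" "1 / (real b + 1) \<le> x" "x < 1 / real b"
      using x0 exists_reciprocal_interval' by blast
    have lb: "l < b"
    proof (rule ccontr)
      assume "\<not> l < b"
      then have "1 / real (Suc l) \<le> 1 / (real b + 1)" using b by (intro frac_le) auto
      then show False using b x by linarith
    qed
    have bn: "b \<le> n"
    proof (rule ccontr)
      assume "\<not> b \<le> n"
      then have "1 / real b \<le> 1 / (real n + 1)" using n_ge by (intro reciprocal_le) auto
      then show False using b False by linarith
    qed
    have w: "0 \<le> 1 / real b - x" using b by simp
    have w': "0 \<le> (1 / real b - x) / contraction b" using w contraction_pos[OF b(1)] by simp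
    have "(\<Sum>j=Suc l..<n + 1. ?m j) = (\<Sum>j=Suc l..<Suc b. ?m j)"
    proof (rule sum.mono_neutral_right)
      show "\<forall>j\<in>{Suc l..<n + 1} - {Suc l..<Suc b}. ?m j = 0"
      proof
        fix j assume j: "j \<in> {Suc l..<n + 1} - {Suc l..<Suc b}"
        then have "1 / real j \<le> x" using b reciprocal_le[of b j] by auto
        then have "gauss_branch j x \<le> 0" using j by (intro gauss_branch_le_0) auto
        then show "?m j = 0" using j l
          by (auto simp: vimage_gauss_inv intro!: mass_eq_0)
      qed
    qed (use bn in auto)
    also have "\<dots> = (\<Sum>j=Suc l..<b. ?m j) + ?m b" using lb by simp
    also have "\<dots> \<le> end_const * (1 / real (Suc l) - 1 / real b) powr h
        + end_const * (1 / real b - x) powr h"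
    proof (rule add_mono)
      show "(\<Sum>j=Suc l..<b. ?m j) \<le> end_const * (1 / real (Suc l) - 1 / real b) powr h"
        using lb bn by (intro full) auto
      have "mass (gauss_inv b -` {x<..<y}) \<le> mass {..<gauss_branch b x}"
        using b bn by (intro mass_mono) (auto simp: vimage_gauss_inv)
      also have "\<dots> \<le> end_const * ((1 / real b - x) / contraction b) powr h"
        using end_bound_end_const w' b(1) unfolding end_bound_def by (simp add: gauss_branch_eq)
      finally show "?m b \<le> end_const * (1 / real b - x) powr h"
        using b w by (intro contraction_powr_mult_le) auto
    qed
    finally show ?thesis
      using lb w by (intro that[of "1 / real (Suc l) - 1 / real b" "1 / real b - x"]) (auto simp: frac_le)
  qed
qed

text \<open>An interval inside one first-level piece is magnified by the inverse of that branch, which at least doubles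
  its length, until it meets two pieces, has length 1 or contains an endpoint of \<open>[0,1]\<close>, which makes it an end interval. An interval meeting two pieces splits into the
  complete pieces and copies of two end intervals, which costs a factor \<open>3\<^sup>1\<^sup>-\<^sup>h\<close>.\<close>

lemma mass_interval_le:
  assumes "x < y"
  shows "mass {x<..<y} \<le> interval_const * (y - x) powr h"
proof -
  \<comment> \<open>So many magnifications suffice to reach length 1.\<close>
  obtain k where k: "1 / (y - x) < 2 ^ k"
    using real_arch_pow[of 2 "1 / (y - x)"] by auto
  have "1 \<le> (y - x) * 2 ^ k" using k assms by (simp add: field_simps)
  then show ?thesis
    using assms
  proof (induction k arbitrary: x y)
    case 0
    have "mass {x<..<y} \<le> 1 * 1" using mass_le_1 by simp
    also have "\<dots> \<le> interval_const * (y - x) powr h"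
      using interval_const_ge 0 h_pos by (intro mult_mono) (auto simp: ge_one_powr_ge_zero)
    finally show ?case .
  next
    case (Suc k)
    have nonneg: "0 \<le> interval_const * (y - x) powr h"
      using interval_const_ge by simp
    consider "y \<le> 1 / (real n + 1)" | "1 < y" "1 \<le> x" | "1 < y" "x < 1" | "1 / (real n + 1) < y" "y \<le> 1"
      by linarith
    then show ?case
    proof cases
      case 1
      have "mass {x<..<y} \<le> mass {..<y}" by (rule mass_mono) auto
      then show ?thesis using mass_lessThan_gap[OF 1] nonneg by simp
    next
      case 2
      have "mass {x<..<y} = 0" by (rule mass_eq_0) (use 2 in auto)
      then show ?thesis using nonneg by simp
    next
      case 3
      have "mass {x<..<y} \<le> mass {1 - (1 - x)<..}" by (rule mass_mono) auto
      also have "\<dots> \<le> end_const * (1 - x) powr h"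
        using end_bound_end_const 3 unfolding end_bound_def by (meson diff_ge_0_iff_ge less_imp_le)
      also have "\<dots> \<le> interval_const * (y - x) powr h"
        using interval_const_ge 3 h_pos by (intro mult_mono powr_mono2) auto
      finally show ?thesis .
    next
      case 4
      then have "0 < y" by (smt (verit) divide_nonneg_nonneg of_nat_0_le_iff)
      then obtain l where l: "1 \<le> l" "1 / (real l + 1) < y" "y \<le> 1 / real l"
        using 4 exists_reciprocal_interval by blast
      have ln: "l \<le> n"
      proof (rule ccontr)
        assume "\<not> l \<le> n"
        then have "1 / real l \<le> 1 / (real n + 1)" using n_ge by (intro reciprocal_le) auto
        then show False using l 4 by linarith
      qed
      have below: "mass (gauss_inv j -` {x<..<y}) = 0" if j: "1 \<le> j" "j < l" for j
      proof -
        have "y \<le> 1 / (real j + 1)" using l reciprocal_le[of j l] j by auto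
        then have "1 \<le> gauss_branch j y" using j by (intro gauss_branch_ge_1)
        then show ?thesis using j ln by (auto simp: vimage_gauss_inv intro!: mass_eq_0)
      qed
      show ?thesis
      proof (cases "1 / (real l + 1) \<le> x")
        case True
        have len: "gauss_branch l x - gauss_branch l y = (y - x) / contraction l"
          using l by (simp add: gauss_branch_eq diff_divide_distrib)
        have "mass {x<..<y} \<le> contraction l powr h * mass (gauss_inv l -` {x<..<y}) +
            (\<Sum>j=1..<1. contraction j powr h)"
        proof (rule mass_le_sum_insert)
          fix j assume j: "1 \<le> j" "j \<le> n" "j < 1 \<or> 1 \<le> j" "j \<noteq> l"
          show "mass (gauss_inv j -` {x<..<y}) = 0"
          proof (cases "j < l")
            case False
            then have "1 / real j \<le> x" using True l reciprocal_le[of l j] j by auto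
            then have "gauss_branch j x \<le> 0" using j by (intro gauss_branch_le_0) auto
            then show ?thesis using j by (auto simp: vimage_gauss_inv intro!: mass_eq_0)
          qed (use below j in auto)
        qed (use l ln in auto)
        also have "\<dots> = contraction l powr h * mass {gauss_branch l y<..<gauss_branch l x}"
          using l ln by (simp add: vimage_gauss_inv)
        also have "\<dots> \<le> interval_const * (y - x) powr h"
        proof (rule contraction_powr_mult_le)
          have "(y - x) * (2 * contraction l) \<le> (y - x) * 1"
            using contraction_le_half[OF l(1)] Suc.prems by (intro mult_left_mono) auto
          then have "(y - x) * 2 \<le> (y - x) / contraction l"
            using contraction_pos[OF l(1)] by (simp only: pos_le_divide_eq mult.assoc mult_1_right)
          then have "(y - x) * 2 * 2 ^ k \<le> (y - x) / contraction l * 2 ^ k"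
            by (rule mult_right_mono) simp
          moreover have "(y - x) * 2 * 2 ^ k = (y - x) * 2 ^ Suc k" by simp
          ultimately have "1 \<le> (gauss_branch l x - gauss_branch l y) * 2 ^ k"
            unfolding len using Suc.prems(1) by linarith
          moreover have "0 < gauss_branch l x - gauss_branch l y"
            unfolding len using Suc.prems contraction_pos[OF l(1)] by simp
          ultimately show "mass {gauss_branch l y<..<gauss_branch l x} \<le>
              interval_const * ((y - x) / contraction l) powr h"
            unfolding len[symmetric] by (intro Suc.IH) auto
        qed (use l Suc.prems in auto)
        finally show ?thesis .
      next
        case False
        then have x: "x < 1 / real (Suc l)" by (simp add: add.commute)
        define u where "u = y - 1 / real (Suc l)"
        have u: "0 \<le> u" using l by (simp add: u_def add.commute)
        let ?m = "\<lambda>j. contraction j powr h * mass (gauss_inv j -` {x<..<y})"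
        obtain v w where vw: "0 \<le> v" "0 \<le> w" "v + w \<le> 1 / real (Suc l) - x"
            "(\<Sum>j=Suc l..<n + 1. ?m j) \<le> end_const * v powr h + end_const * w powr h"
          by (rule mass_interval_rest[OF l(1) ln x])
        have "1 - u / contraction l = gauss_branch l y"
          using one_minus_gauss_branch[of l y] l by (simp add: u_def add.commute)
        moreover have "0 \<le> u / contraction l" using u contraction_pos[OF l(1)] by simp
        ultimately have "mass {gauss_branch l y<..} \<le> end_const * (u / contraction l) powr h"
          using end_bound_end_const unfolding end_bound_def by metis
        moreover have "mass (gauss_inv l -` {x<..<y}) \<le> mass {gauss_branch l y<..}"
          using l ln by (intro mass_mono) (auto simp: vimage_gauss_inv)
        ultimately have ml: "?m l \<le> end_const * u powr h"
          using l u by (intro contraction_powr_mult_le) auto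
        have "mass {x<..<y} = (\<Sum>j=l..<n + 1. ?m j)"
          unfolding mass_rec[of "{x<..<y}"]
          by (rule sum.mono_neutral_right) (use l below in \<open>auto simp: not_le\<close>)
        also have "\<dots> = ?m l + (\<Sum>j=Suc l..<n + 1. ?m j)"
          using ln by (intro sum.atLeast_Suc_lessThan) auto
        also have "\<dots> \<le> end_const * u powr h + (end_const * v powr h + end_const * w powr h)"
          using ml vw by (intro add_mono)
        also have "\<dots> = end_const * (u powr h + v powr h + w powr h)"
          by (simp add: algebra_simps)
        also have "\<dots> \<le> end_const * (3 powr (1 - h) * (u + v + w) powr h)"
          using u vw interval_const_ge h_pos h_less by (intro mult_left_mono powr_add3_le) auto
        also have "\<dots> = interval_const * (u + v + w) powr h"
          by (simp add: interval_const_def)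
        also have "\<dots> \<le> interval_const * (y - x) powr h"
          using interval_const_ge u vw h_pos
          by (intro mult_left_mono powr_mono2) (auto simp: u_def)
        finally show ?thesis .
      qed
    qed
  qed
qed

section \<open>Dimension and measure of the limit set\<close>

lemma mass_empty: "mass {} = 0"
  by (rule mass_eq_0) simp

lemma mass_UN:
  assumes "finite I"
  shows "mass (\<Union>i\<in>I. V i) \<le> (\<Sum>i\<in>I. mass (V i))"
  using assms
proof (induction I rule: finite_induct)
  case (insert i I)
  then show ?case using mass_Un[of "V i" "\<Union>i\<in>I. V i"] by simp
qed (simp add: mass_empty)

text \<open>The mass distribution principle. The intervals around the covering sets are lengthened by amounts whose
  \<open>h\<close>-th powers sum to at most \<open>e\<close>, and compactness reduces the cover to a finite one, to which finite
  subadditivity applies.\<close>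

lemma covering_sum_ge:
  assumes "delta_cover \<delta> (limit_set n) U"
  shows "ennreal (1 / interval_const) \<le> (\<Sum>i. ennreal (diam_pow h (U i)))"
proof (rule ennreal_le_epsilon)
  fix e :: real
  assume e: "0 < e"
  let ?S = interval_const
  have S: "0 < ?S" using interval_const_ge by simp
  define w where "w i = e * (1 / 2) ^ Suc i" for i :: nat
  \<comment> \<open>Chosen such that lengthening by \<open>2 \<eta> i\<close> costs at most \<open>w i\<close> in the \<open>h\<close>-th power.\<close>
  define \<eta> where "\<eta> i = w i powr (1 / h) / 2" for i
  have w: "0 < w i" for i using e by (simp add: w_def)
  have \<eta>: "0 < \<eta> i" "(2 * \<eta> i) powr h = w i" for i
    using w[of i] h_pos by (auto simp: \<eta>_def powr_powr)
  have "\<exists>V. open V \<and> U i \<subseteq> V \<and> mass V \<le> ?S * (diam_pow h (U i) + w i)" for i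
  proof (cases "U i = {}")
    case True
    then show ?thesis using S w[of i] by (intro exI[of _ "{}"]) (simp add: mass_empty diam_pow_def)
  next
    case False
    have b: "bounded (U i)" using assms by (simp add: delta_cover_def)
    obtain a c where ac: "a < c" "U i \<subseteq> {a<..<c}" "c - a \<le> diameter (U i) + 2 * \<eta> i"
      using subset_thickened_interval[OF b \<eta>(1)] by metis
    have "mass {a<..<c} \<le> ?S * (c - a) powr h" by (rule mass_interval_le[OF ac(1)])
    also have "\<dots> \<le> ?S * (diameter (U i) + 2 * \<eta> i) powr h"
      using S ac h_pos by (intro mult_left_mono powr_mono2) auto
    also have "\<dots> \<le> ?S * (diameter (U i) powr h + (2 * \<eta> i) powr h)"
      using S b \<eta>(1) h_pos h_less
      by (intro mult_left_mono powr_add_le_add_powr) (auto simp: diameter_ge_0)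
    also have "\<dots> = ?S * (diam_pow h (U i) + w i)"
      using False h_pos \<eta>(2)[of i] by (simp add: diam_pow_def)
    finally show ?thesis using ac by (intro exI[of _ "{a<..<c}"]) auto
  qed
  then obtain V where V: "\<And>i. open (V i)" "\<And>i. U i \<subseteq> V i"
      "\<And>i. mass (V i) \<le> ?S * (diam_pow h (U i) + w i)"
    by metis
  have "limit_set n \<subseteq> (\<Union>i\<in>UNIV. V i)" using assms V(2) unfolding delta_cover_def by blast
  then obtain I where I: "finite I" "limit_set n \<subseteq> (\<Union>i\<in>I. V i)"
    by (rule compactE_image[OF compact_limit_set V(1)])
  have "1 \<le> mass (\<Union>i\<in>I. V i)" by (rule mass_ge_1[OF I(2)])
  also have "\<dots> \<le> (\<Sum>i\<in>I. mass (V i))" by (rule mass_UN[OF I(1)])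
  also have "\<dots> \<le> (\<Sum>i\<in>I. ?S * (diam_pow h (U i) + w i))" by (intro sum_mono V(3))
  also have "\<dots> = ?S * ((\<Sum>i\<in>I. diam_pow h (U i)) + (\<Sum>i\<in>I. w i))"
    by (simp only: sum_distrib_left[symmetric] sum.distrib)
  finally have "1 / ?S \<le> (\<Sum>i\<in>I. diam_pow h (U i)) + (\<Sum>i\<in>I. w i)"
    using S by (simp add: pos_divide_le_eq mult.commute)
  moreover have "(\<Sum>i\<in>I. w i) \<le> e"
  proof -
    have "w sums (e * 1)" unfolding w_def by (intro sums_mult power_half_series)
    then have "(\<Sum>i\<in>I. w i) \<le> suminf w" "suminf w = e"
      using w I(1) by (auto simp: sums_iff less_imp_le intro: sum_le_suminf)
    then show ?thesis by simp
  qed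
  ultimately have "ennreal (1 / ?S) \<le> ennreal ((\<Sum>i\<in>I. diam_pow h (U i)) + e)"
    by (intro ennreal_leI) simp
  also have "\<dots> = (\<Sum>i\<in>I. ennreal (diam_pow h (U i))) + ennreal e"
    using e by (subst ennreal_plus) (auto simp: sum_nonneg diam_pow_nonneg sum_ennreal)
  also have "\<dots> \<le> (\<Sum>i. ennreal (diam_pow h (U i))) + ennreal e"
    using I(1) by (intro add_right_mono sum_le_suminf) auto
  finally show "ennreal (1 / ?S) \<le> (\<Sum>i. ennreal (diam_pow h (U i))) + ennreal e" .
qed

lemma hausdorff_pre_ge: "ennreal (1 / interval_const) \<le> hausdorff_pre h \<delta> (limit_set n)"
  by (rule hausdorff_pre_greatest) (rule covering_sum_ge)

lemma sum_contraction_powr_less: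
  assumes "h < s"
  shows "(\<Sum>j=1..n. contraction j powr s) < 1"
proof -
  have "(\<Sum>j=1..n. contraction j powr s) < (\<Sum>j=1..n. contraction j powr h)"
  proof (rule sum_strict_mono)
    fix j assume "j \<in> {1..n}"
    then have "0 < contraction j" "contraction j < 1"
      using contraction_pos[of j] contraction_le_half[of j] by auto
    then show "contraction j powr s < contraction j powr h"
      using assms by (intro powr_less_mono') auto
  qed (use n_ge in auto)
  then show ?thesis using sum_powr by simp
qed

lemma limit_dim_eq: "limit_dim n = h"
proof -
  have "{s. 0 \<le> s \<and> hausdorff_measure s (limit_set n) = 0} = {h<..}"
  proof (intro set_eqI iffI)
    fix s assume s: "s \<in> {s. 0 \<le> s \<and> hausdorff_measure s (limit_set n) = 0}"
    have "h < s"
    proof (rule ccontr)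
      assume "\<not> h < s"
      have "0 < ennreal (1 / interval_const)" using interval_const_ge by simp
      also have "\<dots> \<le> hausdorff_pre h 1 (limit_set n)" by (rule hausdorff_pre_ge)
      also have "\<dots> \<le> hausdorff_pre s 1 (limit_set n)"
        using s \<open>\<not> h < s\<close> by (intro hausdorff_pre_exponent_antimono) auto
      also have "\<dots> \<le> hausdorff_measure s (limit_set n)" by (rule hausdorff_pre_le_measure) simp
      finally show False using s by simp
    qed
    then show "s \<in> {h<..}" by simp
  next
    fix s assume "s \<in> {h<..}"
    then show "s \<in> {s. 0 \<le> s \<and> hausdorff_measure s (limit_set n) = 0}"
      using hausdorff_measure_limit_set_eq_0[of s n] sum_contraction_powr_less[of s] h_pos by auto
  qed
  then show ?thesis by (simp add: limit_dim_def hausdorff_dim_def)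
qed

lemma limit_measure_bounds:
  shows "1 / interval_const \<le> limit_measure n"
    and "limit_measure n = enn2real (hausdorff_pre h 1 (limit_set n))"
    and "hausdorff_pre h 1 (limit_set n) = ennreal (limit_measure n)"
proof -
  let ?x = "hausdorff_pre h 1 (limit_set n)"
  have eq: "hausdorff_measure h (limit_set n) = ?x"
    by (intro antisym hausdorff_measure_limit_set_le hausdorff_pre_le_measure)
       (use h_pos sum_powr in auto)
  then show m: "limit_measure n = enn2real ?x" by (simp add: limit_measure_def limit_dim_eq)
  have "?x < top"
    by (rule le_less_trans[OF hausdorff_pre_limit_set_le_1 ennreal_one_less_top]) (use h_pos in simp)
  then show x: "?x = ennreal (limit_measure n)" using m by simp
  have "0 \<le> limit_measure n" using m by simp
  then show "1 / interval_const \<le> limit_measure n"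
    using hausdorff_pre_ge[of 1] x by simp
qed

text \<open>The part of the limit set in the branches \<open>l, \<dots>, n\<close> is covered by a single interval, and each of the
  other pieces by a scaled copy of a cover of the whole set. As the premeasure does not depend on the
  scale, it occurs on both sides, with the factor \<open>1 - \<Sum>\<^sub>j\<^sub>\<ge>\<^sub>l r\<^sub>j\<^sup>h\<close> on the right, and can be solved for.\<close>

lemma limit_measure_le_ratio:
  assumes l: "1 \<le> l" "l \<le> n"
  shows "(\<Sum>j=l..n. contraction j powr h) * limit_measure n \<le> (1 / real l - 1 / (real n + 1)) powr h"
proof -
  let ?J = "limit_set n" and ?F = "{1 / (real n + 1)..1 / real l}"
  let ?x = "limit_measure n" and ?q = "\<Sum>j=1..<l. contraction j powr h"
  have x: "0 \<le> ?x" using limit_measure_bounds(2) by simp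
  have q: "0 \<le> ?q" by (simp add: sum_nonneg)
  have F: "1 / (real n + 1) \<le> 1 / real l" using l by (simp add: frac_le)
  have len: "1 / real l - 1 / (real n + 1) \<le> 1"
  proof -
    have "1 / real l \<le> 1" "0 \<le> 1 / (real n + 1)" using l by auto
    then show ?thesis by linarith
  qed
  have "?J \<subseteq> (\<Union>j\<in>{1..<l}. gauss_inv j ` ?J) \<union> ?F"
  proof
    fix z assume "z \<in> ?J"
    then obtain j y where j: "j \<in> {1..n}" "y \<in> ?J" "z = gauss_inv j y"
      using limit_set_subset_UN by blast
    show "z \<in> (\<Union>j\<in>{1..<l}. gauss_inv j ` ?J) \<union> ?F"
    proof (cases "j < l")
      case False
      have "1 / (real n + 1) \<le> 1 / (real j + 1)" "1 / real j \<le> 1 / real l"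
        using False j l by (auto intro!: frac_le)
      then show ?thesis
        using gauss_inv_image_subset[of j y] limit_set_subset j by fastforce
    qed (use j in auto)
  qed
  then have "hausdorff_pre h 1 ?J \<le> hausdorff_pre h 1 ((\<Union>j\<in>{1..<l}. gauss_inv j ` ?J) \<union> ?F)"
    by (rule hausdorff_pre_subset)
  also have "\<dots> \<le> hausdorff_pre h 1 (\<Union>j\<in>{1..<l}. gauss_inv j ` ?J) + hausdorff_pre h 1 ?F"
    by (rule hausdorff_pre_Un)
  also have "\<dots> \<le> ennreal (?q * ?x) + ennreal ((1 / real l - 1 / (real n + 1)) powr h)"
  proof (rule add_mono)
    have "hausdorff_pre h 1 (\<Union>j\<in>{1..<l}. gauss_inv j ` ?J) \<le> (\<Sum>j=1..<l. hausdorff_pre h 1 (gauss_inv j ` ?J))"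
      by (intro hausdorff_pre_UN) auto
    also have "\<dots> \<le> (\<Sum>j=1..<l. ennreal (contraction j powr h) * hausdorff_pre h 1 ?J)"
    proof (rule sum_mono)
      fix j assume "j \<in> {1..<l}"
      then have "j \<in> {1..n}" using l by auto
      then have "hausdorff_pre h (2 / 2) (gauss_inv j ` ?J) \<le> ennreal (contraction j powr h) * hausdorff_pre h 2 ?J"
        using h_pos by (intro hausdorff_pre_gauss_inv) auto
      also have "\<dots> \<le> ennreal (contraction j powr h) * hausdorff_pre h 1 ?J"
        by (intro mult_left_mono hausdorff_pre_antimono) auto
      finally show "hausdorff_pre h 1 (gauss_inv j ` ?J) \<le> ennreal (contraction j powr h) * hausdorff_pre h 1 ?J"
        by simp
    qed
    also have "\<dots> = ennreal ?q * hausdorff_pre h 1 ?J"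
      by (simp add: sum_distrib_right[symmetric] sum_ennreal)
    also have "\<dots> = ennreal (?q * ?x)"
      using q x by (simp add: limit_measure_bounds(3) ennreal_mult)
    finally show "hausdorff_pre h 1 (\<Union>j\<in>{1..<l}. gauss_inv j ` ?J) \<le> ennreal (?q * ?x)" .
    have "hausdorff_pre h 1 ?F \<le> ennreal (diam_pow h ?F)"
      using F len by (intro hausdorff_pre_le_diam_pow) (auto simp: diameter_closed_interval)
    also have "diam_pow h ?F = (1 / real l - 1 / (real n + 1)) powr h"
      using F h_pos by (simp add: diam_pow_def diameter_closed_interval)
    finally show "hausdorff_pre h 1 ?F \<le> ennreal ((1 / real l - 1 / (real n + 1)) powr h)" .
  qed
  also have "\<dots> = ennreal (?q * ?x + (1 / real l - 1 / (real n + 1)) powr h)"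
    using q x by (intro ennreal_plus[symmetric]) auto
  finally have "ennreal ?x \<le> ennreal (?q * ?x + (1 / real l - 1 / (real n + 1)) powr h)"
    by (simp only: limit_measure_bounds(3))
  then have "?x \<le> ?q * ?x + (1 / real l - 1 / (real n + 1)) powr h"
    by (subst (asm) ennreal_le_iff) (use q x in simp_all)
  moreover have "?q + (\<Sum>j=l..n. contraction j powr h) = 1"
  proof -
    have "{1..n} = {1..<l} \<union> {l..n}" using l by auto
    then have "(\<Sum>j=1..n. contraction j powr h) = ?q + (\<Sum>j=l..n. contraction j powr h)"
      by (simp only: sum.union_disjoint[of "{1..<l}" "{l..n}"] finite_atLeastLessThan finite_atLeastAtMost
          ivl_disj_int)
    then show ?thesis using sum_powr by simp
  qed
  then have p: "(\<Sum>j=l..n. contraction j powr h) = 1 - ?q" by linarith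
  ultimately show ?thesis unfolding p by (simp add: algebra_simps)
qed

lemma contraction_powr_eq:
  assumes "1 \<le> j"
  shows "contraction j powr h = contraction j * exp ((1 - h) * ln (real j * (real j + 1)))"
proof -
  have ln: "ln (real j * (real j + 1)) = - ln (contraction j)"
    using assms by (simp add: contraction_def ln_div)
  then have "contraction j * exp ((1 - h) * ln (real j * (real j + 1))) =
      exp (ln (contraction j)) * exp (- ((1 - h) * ln (contraction j)))"
    using contraction_pos[OF assms] unfolding ln by simp
  also have "\<dots> = exp (ln (contraction j) + - ((1 - h) * ln (contraction j)))"
    by (simp only: exp_add)
  also have "\<dots> = contraction j powr h"
    using contraction_pos[OF assms] by (simp add: powr_def algebra_simps)
  finally show ?thesis by simp
qed

lemma one_minus_limit_measure_le:
  "1 - limit_measure n \<le> (1 - h) * (ln (3 * real n) + 2 * ln 2)"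
proof -
  define P where "P = 2 powr h - 1"
  define Q where "Q = (3 * real n) powr - (1 - h)"
  have P: "0 < P" "P \<le> 1" using two_powr_h by (auto simp: P_def)
  have "1 / interval_const = P * Q"
  proof -
    have "Q = 1 / (3 powr (1 - h) * real n powr (1 - h))"
      by (simp add: Q_def powr_minus_divide powr_mult del: minus_diff_eq)
    then show ?thesis
      by (simp add: interval_const_def end_const_def full_const_def P_def[symmetric])
  qed
  then have PQ: "P * Q \<le> limit_measure n" using limit_measure_bounds(1) by simp
  have "2 powr h = 2 * exp (- ((1 - h) * ln 2))"
    by (simp add: powr_def exp_diff algebra_simps)
  then have P': "1 - P \<le> (1 - h) * (2 * ln 2)"
    using exp_ge_add_one_self[of "- ((1 - h) * ln 2)"] by (simp add: P_def)
  have "Q = exp (- ((1 - h) * ln (3 * real n)))"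
    using n_ge by (simp add: Q_def powr_def del: minus_diff_eq)
  then have Q': "1 - Q \<le> (1 - h) * ln (3 * real n)"
    using exp_ge_add_one_self[of "- ((1 - h) * ln (3 * real n))"] by linarith
  have "1 \<le> (3 * real n) powr (1 - h)" using n_ge h_less by (intro ge_one_powr_ge_zero) auto
  then have "Q \<le> 1"
    by (simp add: Q_def powr_minus inverse_le_1_iff del: minus_diff_eq)
  then have "P * (1 - Q) \<le> 1 * (1 - Q)" using P by (intro mult_right_mono) auto
  then have "1 - P * Q \<le> (1 - P) + (1 - Q)" by (simp add: algebra_simps)
  then show ?thesis using PQ P' Q' by (simp add: algebra_simps)
qed

text \<open>With \<open>l\<close> about \<open>n/2\<close> and \<open>F\<close> the length of the hull, each piece has length at most \<open>1/l\<^sup>2\<close>. So the mass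
  is at least \<open>F l\<^sup>2\<^sup>\<epsilon>\<close>, and \<open>H\<^sub>n \<le> F\<^sup>h / (F l\<^sup>2\<^sup>\<epsilon>) = (F l\<^sup>2)\<^sup>-\<^sup>\<epsilon>\<close>, where \<open>F l\<^sup>2\<close> is of order \<open>n\<close>.\<close>

lemma limit_measure_le: "limit_measure n \<le> exp (- ((1 - h) * ln (real n / 6)))"
proof -
  define l where "l = n div 2"
  define F where "F = 1 / real l - 1 / (real n + 1)"
  let ?e = "1 - h"
  have "1 \<le> l \<and> l \<le> n \<and> n \<le> 3 * l \<and> 2 * l \<le> n" unfolding l_def using n_ge by presburger
  then have l: "1 \<le> l" "l \<le> n" "real n \<le> 3 * real l" "2 * real l \<le> real n" by linarith+
  have "F = (real n + 1 - real l) / (real l * (real n + 1))"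
    using l unfolding F_def by (subst diff_frac_eq) auto
  then have Fl: "F * (real l)\<^sup>2 = real l * ((real n + 1 - real l) / (real n + 1))"
    using l by (simp add: power2_eq_square)
  have "1 / 2 \<le> (real n + 1 - real l) / (real n + 1)" using l by (simp add: field_simps)
  then have "(real n / 3) * (1 / 2) \<le> F * (real l)\<^sup>2"
    unfolding Fl using l by (intro mult_mono) auto
  then have Fl_ge: "real n / 6 \<le> F * (real l)\<^sup>2" by simp
  have "0 < F * (real l)\<^sup>2" using Fl_ge n_ge by linarith
  then have F: "0 < F" using l by (simp add: zero_less_mult_iff)
  have "(real l)\<^sup>2 powr ?e * F = (\<Sum>j=l..n. (real l)\<^sup>2 powr ?e * contraction j)"
  proof -
    have "(\<Sum>j=l..n. contraction j) = (\<Sum>j=l..<n + 1. contraction j)" by (intro sum.cong) auto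
    also have "\<dots> = F" using l by (subst sum_contraction) (auto simp: F_def add.commute)
    finally show ?thesis by (simp add: sum_distrib_left[symmetric])
  qed
  also have "\<dots> \<le> (\<Sum>j=l..n. contraction j powr h)"
  proof (rule sum_mono)
    fix j assume j: "j \<in> {l..n}"
    then have c: "0 < contraction j" using l contraction_pos[of j] by simp
    have "(real l)\<^sup>2 \<le> real j * (real j + 1)"
      unfolding power2_eq_square using j by (intro mult_mono) auto
    then have "(real l)\<^sup>2 powr ?e \<le> (real j * (real j + 1)) powr ?e"
      using h_less by (intro powr_mono2) auto
    also have "\<dots> = exp (?e * ln (real j * (real j + 1)))"
      using j l by (simp add: powr_def)
    finally have "(real l)\<^sup>2 powr ?e * contraction j \<le> exp (?e * ln (real j * (real j + 1))) * contraction j"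
      using c by (intro mult_right_mono) auto
    then show "(real l)\<^sup>2 powr ?e * contraction j \<le> contraction j powr h"
      using j l by (subst contraction_powr_eq) (auto simp: mult.commute)
  qed
  finally have "(real l)\<^sup>2 powr ?e * F * limit_measure n \<le>
      (\<Sum>j=l..n. contraction j powr h) * limit_measure n"
    by (rule mult_right_mono) (simp add: limit_measure_bounds(2))
  also have "\<dots> \<le> F powr h" unfolding F_def using l by (intro limit_measure_le_ratio)
  finally have "limit_measure n \<le> F powr h / ((real l)\<^sup>2 powr ?e * F)"
    using F l by (simp add: pos_le_divide_eq mult.commute)
  also have "\<dots> = (F * (real l)\<^sup>2) powr - ?e"
    using F l by (simp add: powr_mult powr_minus powr_diff field_simps)
  also have "\<dots> \<le> (real n / 6) powr - ?e"
    using Fl_ge n_ge h_less by (intro powr_mono2') auto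
  also have "\<dots> = exp (- (?e * ln (real n / 6)))"
    using n_ge by (simp add: powr_def del: minus_diff_eq)
  finally show ?thesis .
qed

end

section \<open>The dimension defect\<close>

definition lyapunov_sum :: "nat \<Rightarrow> real" where
  "lyapunov_sum n = (\<Sum>j=1..n. contraction j * ln (real j * (real j + 1)))"

lemma exp_minus_one_le: "exp x - 1 \<le> x * exp x" for x :: real
proof -
  have "(1 - x) * exp x \<le> exp (- x) * exp x"
    using exp_ge_add_one_self[of "- x"] by (intro mult_right_mono) auto
  then show ?thesis by (simp add: exp_minus algebra_simps)
qed

context truncated_gauss
begin

text \<open>The difference of \<open>\<Sum> r\<^sub>j\<^sup>h = 1\<close> and \<open>\<Sum> r\<^sub>j = 1 - 1/(n+1)\<close>. The next two lemmas linearize the exponential from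
  below and from above.\<close>

lemma dimension_defect_eq:
  "(\<Sum>j=1..n. contraction j * (exp ((1 - h) * ln (real j * (real j + 1))) - 1)) = 1 / (real n + 1)"
proof -
  have "(\<Sum>j=1..n. contraction j) = (\<Sum>j=1..<n + 1. contraction j)"
    by (intro sum.cong) auto
  also have "\<dots> = 1 / real 1 - 1 / real (n + 1)" by (intro sum_contraction) auto
  finally have "(\<Sum>j=1..n. contraction j) = 1 - 1 / (real n + 1)" by (simp add: add.commute)
  moreover have "(\<Sum>j=1..n. contraction j * exp ((1 - h) * ln (real j * (real j + 1)))) =
      (\<Sum>j=1..n. contraction j powr h)"
    by (intro sum.cong) (auto simp: contraction_powr_eq)
  ultimately show ?thesis
    by (simp only: right_diff_distrib sum_subtractf mult_1_right sum_powr)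
qed

lemma dimension_defect_le: "(1 - h) * lyapunov_sum n \<le> 1 / (real n + 1)"
proof -
  have "(1 - h) * lyapunov_sum n = (\<Sum>j=1..n. contraction j * ((1 - h) * ln (real j * (real j + 1))))"
    by (simp add: lyapunov_sum_def sum_distrib_left algebra_simps)
  also have "\<dots> \<le> (\<Sum>j=1..n. contraction j * (exp ((1 - h) * ln (real j * (real j + 1))) - 1))"
  proof (intro sum_mono mult_left_mono)
    fix j assume "j \<in> {1..n}"
    then show "0 \<le> contraction j" using contraction_pos[of j] by simp
    show "(1 - h) * ln (real j * (real j + 1)) \<le> exp ((1 - h) * ln (real j * (real j + 1))) - 1"
      using exp_ge_add_one_self[of "(1 - h) * ln (real j * (real j + 1))"] by linarith
  qed
  finally show ?thesis unfolding dimension_defect_eq .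
qed

lemma dimension_defect_ge:
  "1 / (real n + 1) \<le> (1 - h) * lyapunov_sum n * exp ((1 - h) * ln (real n * (real n + 1)))"
proof -
  let ?L = "\<lambda>j. ln (real j * (real j + 1))"
  have "1 / (real n + 1) = (\<Sum>j=1..n. contraction j * (exp ((1 - h) * ?L j) - 1))"
    unfolding dimension_defect_eq ..
  also have "\<dots> \<le> (\<Sum>j=1..n. contraction j * ((1 - h) * ?L j * exp ((1 - h) * ?L n)))"
  proof (intro sum_mono mult_left_mono)
    fix j assume j: "j \<in> {1..n}"
    then show "0 \<le> contraction j" using contraction_pos[of j] by simp
    have ge: "1 * 1 \<le> real j * (real j + 1)" using j by (intro mult_mono) auto
    have "real j * (real j + 1) \<le> real n * (real n + 1)" using j by (intro mult_mono) auto
    then have "?L j \<le> ?L n" "0 \<le> ?L j" using ge by (auto intro!: ln_mono)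
    then have "(1 - h) * ?L j * exp ((1 - h) * ?L j) \<le> (1 - h) * ?L j * exp ((1 - h) * ?L n)"
      using h_less by (intro mult_left_mono) (auto intro!: mult_left_mono)
    then show "exp ((1 - h) * ?L j) - 1 \<le> (1 - h) * ?L j * exp ((1 - h) * ?L n)"
      using exp_minus_one_le[of "(1 - h) * ?L j"] by linarith
  qed
  also have "\<dots> = (1 - h) * lyapunov_sum n * exp ((1 - h) * ?L n)"
    by (simp add: lyapunov_sum_def sum_distrib_left sum_distrib_right algebra_simps)
  finally show ?thesis .
qed

end

text \<open>The sum \<open>\<Sum> r\<^sub>j\<^sup>s\<close> decreases from \<open>n\<close> at \<open>s = 0\<close> to \<open>1 - 1/(n+1)\<close> at \<open>s = 1\<close>.\<close>

lemma truncated_gauss_exists: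
  assumes "2 \<le> n"
  shows "\<exists>h. truncated_gauss n h"
proof -
  define f where "f s = (\<Sum>j=1..n. contraction j powr s)" for s
  have f0: "f 0 = real n"
  proof -
    have "f 0 = (\<Sum>j=1..n. 1)" unfolding f_def using contraction_pos by (intro sum.cong) fastforce+
    then show ?thesis by simp
  qed
  have f1: "f 1 = 1 - 1 / (real n + 1)"
  proof -
    have "f 1 = (\<Sum>j=1..<n + 1. contraction j)"
      unfolding f_def using contraction_pos by (intro sum.cong) (auto simp: less_imp_le)
    also have "\<dots> = 1 / real 1 - 1 / real (n + 1)" by (intro sum_contraction) auto
    finally show ?thesis by (simp add: add.commute)
  qed
  have "continuous_on {0..1} f"
    unfolding f_def using contraction_pos by (intro continuous_intros) fastforce
  moreover have "f 1 \<le> 1" "1 \<le> f 0" using f0 f1 assms by auto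
  ultimately obtain h where h: "0 \<le> h" "h \<le> 1" "f h = 1"
    using IVT2'[of f 1 1 0] by auto
  moreover have "h \<noteq> 0" "h \<noteq> 1"
    using h f0 f1 assms by auto
  ultimately show ?thesis
    using assms by (intro exI[of _ h]) (auto simp: truncated_gauss_def f_def)
qed

section \<open>The Lyapunov exponent\<close>

lemma lin_gauss_deriv:
  assumes "x \<in> {1 / (real k + 1)<..<1 / real k}" "1 \<le> k"
  shows "deriv lin_gauss x = - (real k * (real k + 1))"
proof -
  have "lin_gauss y = gauss_branch k y" if "y \<in> {1 / (real k + 1)<..<1 / real k}" for y
  proof -
    have "0 < 1 / (real k + 1)" by simp
    then have "0 < y" using that unfolding greaterThanLessThan_iff by linarith
    then have "real k < 1 / y" "1 / y < real k + 1"
      using that assms(2) by (auto simp: field_simps)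
    then have "\<lfloor>1 / y\<rfloor> = int k" by (intro floor_unique) auto
    then show ?thesis by (simp add: lin_gauss_def)
  qed
  moreover have "(gauss_branch k has_field_derivative - (real k * (real k + 1))) (at x)"
    unfolding gauss_branch_def by (auto intro!: derivative_eq_intros)
  ultimately have "(lin_gauss has_field_derivative - (real k * (real k + 1))) (at x)"
    using assms(1)
    by (intro has_field_derivative_transform_within_open[of "gauss_branch k" _ x
          "{1 / (real k + 1)<..<1 / real k}" lin_gauss]) auto
  then show ?thesis by (rule DERIV_imp_deriv)
qed

lemma summable_lyapunov:
  "summable (\<lambda>k. 1 / (real (Suc k) * (real (Suc k) + 1)) * ln (real (Suc k) * (real (Suc k) + 1)))"
proof (rule summable_comparison_test_bigo)
  show "summable (\<lambda>k. norm (real k powr - (3 / 2)))"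
    by (simp add: summable_real_powr_iff)
  show "(\<lambda>k. 1 / (real (Suc k) * (real (Suc k) + 1)) * ln (real (Suc k) * (real (Suc k) + 1)))
      \<in> O(\<lambda>k. real k powr - (3 / 2))"
    by real_asymp
qed

text \<open>Off a countable set the integrand is the sum of the constants \<open>ln (k(k+1))\<close> on the disjoint intervals
  \<open>(1/(k+1), 1/k)\<close>. The exceptional set consists of 0 and the common endpoints.\<close>

lemma lyapunov_integral:
  shows "set_integrable lborel {0..1} (\<lambda>x. ln \<bar>deriv lin_gauss x\<bar>)" (is ?int)
    and "(\<lambda>k. 1 / (real (Suc k) * (real (Suc k) + 1)) * ln (real (Suc k) * (real (Suc k) + 1)))
      sums lyapunov" (is "?t sums _")
proof -
  define A where "A k = {1 / (real (Suc k) + 1)<..<1 / real (Suc k)}" for k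
  define c where "c k = ln (real (Suc k) * (real (Suc k) + 1))" for k
  define f where "f k x = c k * indicator (A k) x" for k x
  define X where "X = insert 0 (range (\<lambda>k. 1 / real (Suc k)))"
  have c: "0 \<le> c k" for k
  proof -
    have "1 * 1 \<le> real (Suc k) * (real (Suc k) + 1)" by (intro mult_mono) auto
    then show ?thesis by (simp add: c_def)
  qed
  have len: "measure lborel (A k) = 1 / (real (Suc k) * (real (Suc k) + 1))" for k
  proof -
    have "1 / (real (Suc k) + 1) \<le> 1 / real (Suc k)" by (simp add: frac_le)
    then have "measure lborel (A k) = 1 / real (Suc k) - 1 / (real (Suc k) + 1)" by (simp add: A_def)
    then show ?thesis using contraction_eq[of "Suc k"] unfolding contraction_def by simp
  qed
  have fin: "emeasure lborel (A k) < \<infinity>" for k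
    unfolding A_def using emeasure_lborel_Ioo[of "1 / (real (Suc k) + 1)" "1 / real (Suc k)"]
    by (simp add: frac_le)
  have f_int: "integrable lborel (f k)" "integral\<^sup>L lborel (f k) = ?t k" for k
    unfolding f_def using fin[of k] len[of k] by (auto simp: A_def c_def)
  have unique: "i = k" if "x \<in> A i" "x \<in> A k" for i k x
  proof -
    have disjoint: "\<not> a < b" if "x \<in> A a" "x \<in> A b" for a b
    proof
      assume "a < b"
      have "1 / real (Suc b) \<le> 1 / (real (Suc a) + 1)" using \<open>a < b\<close> by (intro frac_le) auto
      moreover have "1 / (real (Suc a) + 1) < x" "x < 1 / real (Suc b)"
        using that unfolding A_def greaterThanLessThan_iff by blast+
      ultimately show False by (meson le_less_trans less_asym)
    qed
    show ?thesis using disjoint[OF that] disjoint[OF that(2,1)] by simp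
  qed
  have single: "(\<lambda>i. f i x) sums c k" if "x \<in> A k" for k x
  proof -
    have "f i x = (if i = k then c i else 0)" for i
    proof (cases "i = k")
      case False
      then have "x \<notin> A i" using unique that by blast
      then show ?thesis using False by (simp add: f_def)
    qed (simp add: f_def that)
    then show ?thesis using sums_single[of k c] by (simp only:)
  qed
  have none: "(\<lambda>i. f i x) sums 0" if "\<And>k. x \<notin> A k" for x
    using that by (simp add: f_def)
  have abs_summable: "summable (\<lambda>i. norm (f i x))" for x
  proof -
    have "norm (f i x) = f i x" for i using c by (simp add: f_def)
    moreover have "summable (\<lambda>i. f i x)"
      using sums_summable[OF single] sums_summable[OF none] by (cases "\<exists>k. x \<in> A k") blast+
    ultimately show ?thesis by simp
  qed
  have norm_summable: "summable (\<lambda>i. \<integral>x. norm (f i x) \<partial>lborel)"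
  proof -
    have "norm (f i x) = f i x" for i x using c by (simp add: f_def)
    then show ?thesis using f_int(2) summable_lyapunov by simp
  qed
  have int: "integrable lborel (\<lambda>x. \<Sum>i. f i x)"
    using f_int(1) abs_summable norm_summable by (intro integrable_suminf) auto
  have sums: "(\<lambda>i. integral\<^sup>L lborel (f i)) sums (\<integral>x. (\<Sum>i. f i x) \<partial>lborel)"
    using f_int(1) abs_summable norm_summable by (intro sums_integral) auto
  have eq: "(\<Sum>i. f i x) = indicator {0..1} x *\<^sub>R ln \<bar>deriv lin_gauss x\<bar>" if "x \<notin> X" for x
  proof (cases "x \<in> {0..1}")
    case True
    have "x \<noteq> 0" using that by (auto simp: X_def)
    then obtain l where l: "1 \<le> l" "1 / (real l + 1) < x" "x \<le> 1 / real l"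
      using exists_reciprocal_interval[of x] True by auto
    then obtain k where k: "l = Suc k" by (cases l) auto
    have "x \<noteq> 1 / real (Suc k)" using that unfolding X_def by blast
    then have "x \<in> A k" using l by (simp add: A_def k)
    then have "(\<Sum>i. f i x) = c k" using single by (simp add: sums_iff)
    moreover have "deriv lin_gauss x = - (real (Suc k) * (real (Suc k) + 1))"
      using \<open>x \<in> A k\<close> unfolding A_def by (intro lin_gauss_deriv) auto
    then have "ln \<bar>deriv lin_gauss x\<bar> = c k" by (simp add: c_def)
    ultimately show ?thesis using True by simp
  next
    case False
    have "x \<notin> A k" for k
    proof
      assume x: "x \<in> A k"
      have "0 < 1 / (real (Suc k) + 1)" "1 / real (Suc k) \<le> 1" by auto
      then show False using x False unfolding A_def greaterThanLessThan_iff atLeastAtMost_iff by linarith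
    qed
    then show ?thesis using none False by (simp add: sums_iff)
  qed
  have X: "countable X" by (simp add: X_def)
  show ?int
    unfolding set_integrable_def
    using int by (subst (asm) integrable_discrete_difference[OF X, where g =
          "\<lambda>x. indicator {0..1} x *\<^sub>R ln \<bar>deriv lin_gauss x\<bar>"]) (auto simp: eq)
  have "lyapunov = (\<integral>x. (\<Sum>i. f i x) \<partial>lborel)"
    unfolding lyapunov_def set_lebesgue_integral_def
    by (rule integral_discrete_difference[OF X, symmetric]) (auto simp: eq)
  then show "?t sums lyapunov" using sums f_int(2) by simp
qed

lemma lyapunov_sum_tendsto: "lyapunov_sum \<longlonglongrightarrow> lyapunov"
proof -
  have *: "lyapunov_sum n =
      (\<Sum>k<n. 1 / (real (Suc k) * (real (Suc k) + 1)) * ln (real (Suc k) * (real (Suc k) + 1)))" for n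
    unfolding lyapunov_sum_def contraction_def by (simp only: One_nat_def sum.atLeast1_atMost_eq)
  show ?thesis using lyapunov_integral(2) unfolding sums_def *[symmetric] .
qed

lemma lyapunov_sum_mono: "m \<le> n \<Longrightarrow> lyapunov_sum m \<le> lyapunov_sum n"
  unfolding lyapunov_sum_def
proof (rule sum_mono2)
  fix j assume "m \<le> n" "j \<in> {1..n} - {1..m}"
  then have j: "1 \<le> j" by simp
  then have "1 * 1 \<le> real j * (real j + 1)" by (intro mult_mono) auto
  then show "0 \<le> contraction j * ln (real j * (real j + 1))"
    using contraction_pos[OF j] by simp
qed auto

lemma lyapunov_sum_pos: "1 \<le> n \<Longrightarrow> 0 < lyapunov_sum n"
  using lyapunov_sum_mono[of 1 n] by (simp add: lyapunov_sum_def contraction_def)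
    (smt (verit) ln_gt_zero)

lemma lyapunov_pos: "0 < lyapunov"
proof -
  have "lyapunov_sum 1 \<le> lyapunov"
    using lyapunov_sum_tendsto lyapunov_sum_mono by (intro LIMSEQ_le_const) auto
  then show ?thesis using lyapunov_sum_pos[of 1] by simp
qed

section \<open>The limits\<close>

lemma truncated_gauss_limit_dim: "2 \<le> n \<Longrightarrow> truncated_gauss n (limit_dim n)"
  using truncated_gauss_exists truncated_gauss.limit_dim_eq by metis

text \<open>The lower linearization gives \<open>\<epsilon> = O(1/n)\<close>. Hence \<open>\<epsilon> ln (n(n+1))\<close>, the exponent of the correction factor in the
  upper one, tends to 0, and both bounds for \<open>n \<epsilon>\<close> have the limit \<open>1/\<chi>\<close>.\<close>

lemma dimension_defect_tendsto: "(\<lambda>n. real n * (1 - limit_dim n)) \<longlonglongrightarrow> 1 / lyapunov"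
proof -
  define e where "e n = 1 - limit_dim n" for n
  define L where "L n = ln (real n * (real n + 1))" for n :: nat
  have bounds: "0 < e n" "e n \<le> 1 / (real n + 1) * (1 / lyapunov_sum n)"
      "1 / (real n + 1) \<le> e n * lyapunov_sum n * exp (e n * L n)" "0 < lyapunov_sum n" if "2 \<le> n" for n
  proof -
    interpret truncated_gauss n "limit_dim n" by (rule truncated_gauss_limit_dim[OF that])
    show "0 < lyapunov_sum n" using that by (intro lyapunov_sum_pos) auto
    then have "e n \<le> 1 / (real n + 1) / lyapunov_sum n"
      using dimension_defect_le by (simp only: e_def pos_le_divide_eq)
    then show "e n \<le> 1 / (real n + 1) * (1 / lyapunov_sum n)" by simp
    show "0 < e n" using h_less by (simp add: e_def)
    show "1 / (real n + 1) \<le> e n * lyapunov_sum n * exp (e n * L n)"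
      using dimension_defect_ge by (simp add: e_def L_def)
  qed
  have inv: "(\<lambda>n. 1 / lyapunov_sum n) \<longlonglongrightarrow> 1 / lyapunov"
    using lyapunov_pos by (intro tendsto_intros lyapunov_sum_tendsto) auto
  have "(\<lambda>n. L n / (real n + 1)) \<longlonglongrightarrow> 0"
    unfolding L_def by real_asymp
  then have "(\<lambda>n. L n / (real n + 1) * (1 / lyapunov_sum n)) \<longlonglongrightarrow> 0 * (1 / lyapunov)"
    using inv by (rule tendsto_mult)
  moreover have L_nonneg: "0 \<le> L n" if "2 \<le> n" for n
  proof -
    have "1 * 1 \<le> real n * (real n + 1)" using that by (intro mult_mono) auto
    then show ?thesis by (simp add: L_def)
  qed
  have "0 \<le> e n * L n \<and> e n * L n \<le> L n / (real n + 1) * (1 / lyapunov_sum n)" if "2 \<le> n" for n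
  proof
    show "0 \<le> e n * L n" using bounds(1)[OF that] L_nonneg[OF that] by simp
    show "e n * L n \<le> L n / (real n + 1) * (1 / lyapunov_sum n)"
      using mult_right_mono[OF bounds(2)[OF that] L_nonneg[OF that]] by (simp add: mult_ac)
  qed
  ultimately have eL: "(\<lambda>n. e n * L n) \<longlonglongrightarrow> 0"
    by (intro tendsto_sandwich[of "\<lambda>_. 0" "\<lambda>n. e n * L n" sequentially
          "\<lambda>n. L n / (real n + 1) * (1 / lyapunov_sum n)"])
       (auto intro: eventually_sequentiallyI[of 2])
  have ratio: "(\<lambda>n. real n / (real n + 1)) \<longlonglongrightarrow> 1" by real_asymp
  have up: "(\<lambda>n. real n / (real n + 1) * (1 / lyapunov_sum n)) \<longlonglongrightarrow> 1 * (1 / lyapunov)"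
    by (intro tendsto_mult ratio inv)
  have low: "(\<lambda>n. real n / (real n + 1) * (1 / lyapunov_sum n) * exp (- (e n * L n))) \<longlonglongrightarrow>
      1 * (1 / lyapunov) * exp (- 0)"
    by (intro tendsto_mult ratio inv tendsto_exp tendsto_minus eL)
  have "(\<lambda>n. real n * e n) \<longlonglongrightarrow> 1 / lyapunov"
  proof (rule tendsto_sandwich)
    show "\<forall>\<^sub>F n in sequentially. real n / (real n + 1) * (1 / lyapunov_sum n) * exp (- (e n * L n)) \<le> real n * e n"
    proof (rule eventually_sequentiallyI)
      fix n :: nat assume n: "2 \<le> n"
      have "1 / (real n + 1) * (1 / lyapunov_sum n) * exp (- (e n * L n)) \<le>
          (e n * lyapunov_sum n * exp (e n * L n)) * (1 / lyapunov_sum n) * exp (- (e n * L n))"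
        using bounds(3)[OF n] bounds(4)[OF n] by (intro mult_right_mono) auto
      also have "\<dots> = e n" using bounds(4)[OF n] by (simp add: exp_minus)
      finally have "real n * (1 / (real n + 1) * (1 / lyapunov_sum n) * exp (- (e n * L n))) \<le> real n * e n"
        by (rule mult_left_mono) simp
      then show "real n / (real n + 1) * (1 / lyapunov_sum n) * exp (- (e n * L n)) \<le> real n * e n"
        by simp
    qed
    show "\<forall>\<^sub>F n in sequentially. real n * e n \<le> real n / (real n + 1) * (1 / lyapunov_sum n)"
    proof (rule eventually_sequentiallyI)
      fix n :: nat assume "2 \<le> n"
      then show "real n * e n \<le> real n / (real n + 1) * (1 / lyapunov_sum n)"
        using mult_left_mono[OF bounds(2), of n "real n"] by simp
    qed
  qed (use up low in simp_all)
  then show ?thesis by (simp add: e_def)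
qed

text \<open>The bounds for \<open>H\<^sub>n\<close> are \<open>exp (-\<epsilon> (ln n + O(1)))\<close> up to \<open>O(\<epsilon>)\<close>, and \<open>\<epsilon> ln n\<close> tends to 0 because
  \<open>n \<epsilon>\<close> converges.\<close>

lemma measure_dimension_ratio_tendsto:
  "(\<lambda>n. (1 - limit_measure n) / (1 - limit_dim n) * (1 / ln (real n))) \<longlonglongrightarrow> 1"
proof -
  define e where "e n = 1 - limit_dim n" for n
  have bounds: "0 < e n" "1 - limit_measure n \<le> e n * (ln (3 * real n) + 2 * ln 2)"
      "limit_measure n \<le> exp (- (e n * ln (real n / 6)))" if "2 \<le> n" for n
  proof -
    interpret truncated_gauss n "limit_dim n" by (rule truncated_gauss_limit_dim[OF that])
    show "0 < e n" "1 - limit_measure n \<le> e n * (ln (3 * real n) + 2 * ln 2)"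
      "limit_measure n \<le> exp (- (e n * ln (real n / 6)))"
      using h_less one_minus_limit_measure_le limit_measure_le by (simp_all add: e_def)
  qed
  have "(\<lambda>n. ln (real n / 6) / real n) \<longlonglongrightarrow> 0" by real_asymp
  then have "(\<lambda>n. real n * e n * (ln (real n / 6) / real n)) \<longlonglongrightarrow> 1 / lyapunov * 0"
    unfolding e_def by (intro tendsto_mult dimension_defect_tendsto)
  moreover have "\<forall>\<^sub>F n in sequentially. real n * e n * (ln (real n / 6) / real n) = e n * ln (real n / 6)"
    by (rule eventually_sequentiallyI[of 1]) auto
  ultimately have "(\<lambda>n. e n * ln (real n / 6)) \<longlonglongrightarrow> 1 / lyapunov * 0"
    by (rule Lim_transform_eventually)
  then have y0: "(\<lambda>n. e n * ln (real n / 6)) \<longlonglongrightarrow> 0" by simp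
  have "(\<lambda>n. ln (real n / 6) / ln (real n)) \<longlonglongrightarrow> 1" by real_asymp
  then have low: "(\<lambda>n. ln (real n / 6) / ln (real n) / (1 + e n * ln (real n / 6))) \<longlonglongrightarrow> 1 / (1 + 0)"
    by (intro tendsto_intros y0) auto
  have up: "(\<lambda>n. (ln (3 * real n) + 2 * ln 2) / ln (real n)) \<longlonglongrightarrow> 1" by real_asymp
  have "(\<lambda>n. (1 - limit_measure n) / e n * (1 / ln (real n))) \<longlonglongrightarrow> 1"
  proof (rule tendsto_sandwich)
    show "\<forall>\<^sub>F n in sequentially. ln (real n / 6) / ln (real n) / (1 + e n * ln (real n / 6)) \<le>
        (1 - limit_measure n) / e n * (1 / ln (real n))"
    proof (rule eventually_sequentiallyI)
      fix n :: nat assume n: "6 \<le> n"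
      let ?y = "e n * ln (real n / 6)"
      have e: "0 < e n" using bounds(1) n by simp
      have y: "0 \<le> ?y" using e n by simp
      have ln: "0 < ln (real n)" using n by simp
      have "exp (- ?y) \<le> 1 / (1 + ?y)"
        using exp_ge_add_one_self[of ?y] y by (simp add: exp_minus field_simps)
      then have "1 - 1 / (1 + ?y) \<le> 1 - limit_measure n" using bounds(3)[of n] n by simp
      moreover have "1 - 1 / (1 + ?y) = ?y / (1 + ?y)" using y by (simp add: field_simps)
      ultimately have "?y / (1 + ?y) / e n * (1 / ln (real n)) \<le> (1 - limit_measure n) / e n * (1 / ln (real n))"
        using e ln by (intro mult_right_mono divide_right_mono) auto
      moreover have "?y / (1 + ?y) / e n * (1 / ln (real n)) = ln (real n / 6) / ln (real n) / (1 + ?y)"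
        using e by simp
      ultimately show "ln (real n / 6) / ln (real n) / (1 + ?y) \<le>
          (1 - limit_measure n) / e n * (1 / ln (real n))" by simp
    qed
    show "\<forall>\<^sub>F n in sequentially. (1 - limit_measure n) / e n * (1 / ln (real n)) \<le>
        (ln (3 * real n) + 2 * ln 2) / ln (real n)"
    proof (rule eventually_sequentiallyI)
      fix n :: nat assume n: "2 \<le> n"
      have "(1 - limit_measure n) / e n \<le> ln (3 * real n) + 2 * ln 2"
        using bounds(1,2)[OF n] by (simp add: pos_divide_le_eq mult.commute)
      then have "(1 - limit_measure n) / e n * (1 / ln (real n)) \<le>
          (ln (3 * real n) + 2 * ln 2) * (1 / ln (real n))"
        by (rule mult_right_mono) (use n in simp)
      then show "(1 - limit_measure n) / e n * (1 / ln (real n)) \<le> (ln (3 * real n) + 2 * ln 2) / ln (real n)"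
        by simp
    qed
  qed (use low up in simp_all)
  then show ?thesis by (simp add: e_def)
qed

theorem theorem6p1:
  shows "((\<lambda>n. (1 - limit_measure n) / (1 - limit_dim n) * (1 / ln (real n))) \<longlonglongrightarrow> 1) \<and>
    ((\<lambda>n. real n * (1 - limit_measure n) / ln (real n)) \<longlonglongrightarrow> 1 / lyapunov) \<and>
    set_integrable lborel {0..1} (\<lambda>x. ln \<bar>deriv lin_gauss x\<bar>) \<and>
    ((\<lambda>k. 1 / (real (Suc k) * (real (Suc k) + 1)) * ln (real (Suc k) * (real (Suc k) + 1)))
      sums lyapunov)"
proof (intro conjI measure_dimension_ratio_tendsto lyapunov_integral)
  have "(\<lambda>n. (1 - limit_measure n) / (1 - limit_dim n) * (1 / ln (real n)) * (real n * (1 - limit_dim n)))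
      \<longlonglongrightarrow> 1 * (1 / lyapunov)"
    by (intro tendsto_mult measure_dimension_ratio_tendsto dimension_defect_tendsto)
  moreover have "(1 - limit_measure n) / (1 - limit_dim n) * (1 / ln (real n)) * (real n * (1 - limit_dim n)) =
      real n * (1 - limit_measure n) / ln (real n)" if "2 \<le> n" for n
  proof -
    interpret truncated_gauss n "limit_dim n" by (rule truncated_gauss_limit_dim[OF that])
    show ?thesis using h_less by simp
  qed
  then have "\<forall>\<^sub>F n in sequentially.
      (1 - limit_measure n) / (1 - limit_dim n) * (1 / ln (real n)) * (real n * (1 - limit_dim n)) =
      real n * (1 - limit_measure n) / ln (real n)"
    by (rule eventually_sequentiallyI)
  ultimately have "(\<lambda>n. real n * (1 - limit_measure n) / ln (real n)) \<longlonglongrightarrow> 1 * (1 / lyapunov)"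
    by (rule Lim_transform_eventually)
  then show "(\<lambda>n. real n * (1 - limit_measure n) / ln (real n)) \<longlonglongrightarrow> 1 / lyapunov"
    by (simp only: mult_1_left)
qed

end
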